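(* Consider the causal secure source coding model with degraded side information described in the context. A quadruple $(R,R_k,D,h)$ belongs to $\mathcal{R}_{SI}$ if and only if $$R\ge \underline{r}_c^{SI}(D),\qquad h\le H(X\mid W),\qquad R_k\ge h-H(X\mid W)+\underline{r}_c^{SI}(D).$$
   Context: A memoryless source emits i.i.d. triples $(X_t,Y_t,W_t)$ on finite alphabets with joint law $P(x)P(y\mid x)P(w\mid y)$ (so $X\leftrightarrow Y\leftrightarrow W$). Alice observes $X^n$, Bob observes side information $Y^n$, the eavesdropper Eve observes $W^n$. Alice and Bob share a secret key $K$ taking finitely many values, independent of the source. A causal reproduction coder consists of causal encoding functions producing messages $S_t=e_t(K,X^t)$ (in a finite alphabet) and causal decoding functions $\hat X_t=g_t(K,S^t,Y^t)\in\hat{\mathcal{X}}$ ($\hat{\mathcal{X}}$ finite). Alice transmits a binary string $\mathbf{Z}$, a function of $(K,X^n)$, and it is required that for every $\epsilon>0$ and large enough $n$, $P(S^n\ne g(K,Y^n,\mathbf{Z}))<\epsilon$ for some function $g$. A distortion measure $d:\mathcal{X}\times\hat{\mathcal{X}}\to[0,\infty)$ is given. $\mathcal{R}_{SI}$ is the set of quadruples $(R,R_k,D,h)$ of positive reals such that for every $\epsilon>0$ and sufficiently large $n$ there exist an encoder and decoder inducing a causal reproduction coder with $\frac1nH(\mathbf{Z})\le R+\epsilon$, $\frac1nH(K)\le R_k+\epsilon$, $\frac1n\sum_{t=1}^n\mathbb{E}\,d(X_t,\hat X_t)\le D+\epsilon$, and $\frac1nH(X^n\mid W^n,\mathbf{Z})\ge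 h-\epsilon$. Define $r_c^{SI}(D)=\min H(f(X)\mid Y)$ over finite alphabets $\mathcal{S}$ with $|\mathcal{S}|\le|\mathcal{X}|$ and functions $f:\mathcal{X}\to\mathcal{S}$, $g:\mathcal{S}\times\mathcal{Y}\to\hat{\mathcal{X}}$ satisfying $\mathbb{E}\,d(X,g(f(X),Y))\le D$; $\underline{r}_c^{SI}(D)$ is the lower convex envelope of $r_c^{SI}(D)$. *)

theory Defs
  imports "HOL-Probability.Probability"
begin

definition ent :: "'a pmf \<Rightarrow> ('a \<Rightarrow> 'b) \<Rightarrow> real" where
  "ent \<mu> f = (\<Sum>b\<in>f ` set_pmf \<mu>.
      - measure_pmf.prob \<mu> (f -` {b}) * log 2 (measure_pmf.prob \<mu> (f -` {b})))"

definition cond_ent :: "'a pmf \<Rightarrow> ('a \<Rightarrow> 'b) \<Rightarrow> ('a \<Rightarrow> 'c) \<Rightarrow> real" where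
  "cond_ent \<mu> f g = ent \<mu> (\<lambda>a. (f a, g a)) - ent \<mu> g"

definition src :: "'x pmf \<Rightarrow> ('x \<Rightarrow> 'y pmf) \<Rightarrow> ('y \<Rightarrow> 'w pmf) \<Rightarrow> ('x \<times> 'y \<times> 'w) pmf" where
  "src Px Py Pw = do { x \<leftarrow> Px; y \<leftarrow> Py x; w \<leftarrow> Pw y; return_pmf (x, y, w) }"

definition src_n :: "('x \<times> 'y \<times> 'w) pmf \<Rightarrow> nat \<Rightarrow> (nat \<Rightarrow> 'x \<times> 'y \<times> 'w) pmf" where
  "src_n P n = Pi_pmf {..<n} undefined (\<lambda>_. P)"

text \<open>r_c^SI(D): minimum of H(f(X)|Y) over f : X -> S (|S| <= |X|, S taken as {0..<|X|})
  and g : S x Y -> Xhat with E d(X, g(f X, Y)) <= D; +infinity if infeasible.\<close>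
definition rc_SI :: "'x::finite pmf \<Rightarrow> ('x \<Rightarrow> 'y::finite pmf) \<Rightarrow> ('y \<Rightarrow> 'w::finite pmf)
    \<Rightarrow> ('x \<Rightarrow> 'xh::finite \<Rightarrow> real) \<Rightarrow> real \<Rightarrow> ereal" where
  "rc_SI Px Py Pw d D = Inf {ereal (cond_ent (src Px Py Pw) (\<lambda>(x,y,w). f x) (\<lambda>(x,y,w). y)) | f g.
      (\<forall>x. f x < CARD('x)) \<and>
      measure_pmf.expectation (src Px Py Pw) (\<lambda>(x,y,w). d x ((g :: nat \<Rightarrow> 'y \<Rightarrow> 'xh) (f x) y)) \<le> D}"

definition lower_convex_env :: "(real \<Rightarrow> ereal) \<Rightarrow> real \<Rightarrow> ereal" where
  "lower_convex_env r D = Sup {ereal (c D) | c. convex_on UNIV c \<and> (\<forall>D'. ereal (c D') \<le> r D')}"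

text \<open>Membership of (R, Rk, D, h) in the region R_SI.  Sample space at blocklength n:
  pairs (k, s) with key k ~ kappa independent of the i.i.d. source block s.
  Encoder e t k x^n: message S_t (causal: depends on x_0..x_t); decoder g t k s y: Xhat_t
  (causal in s and y); z k x^n: transmitted binary string Z; gd k y^n Z: recovery of S^n.\<close>
definition in_RSI :: "'x::finite pmf \<Rightarrow> ('x \<Rightarrow> 'y::finite pmf) \<Rightarrow> ('y \<Rightarrow> 'w::finite pmf)
    \<Rightarrow> ('x \<Rightarrow> 'xh::finite \<Rightarrow> real) \<Rightarrow> real \<Rightarrow> real \<Rightarrow> real \<Rightarrow> real \<Rightarrow> bool" where
  "in_RSI Px Py Pw d R Rk D h \<longleftrightarrow> R > 0 \<and> Rk > 0 \<and> D > 0 \<and> h > 0 \<and>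
    (\<forall>\<epsilon>>0. \<exists>N. \<forall>n\<ge>N.
      \<exists>(\<kappa> :: nat pmf) (e :: nat \<Rightarrow> nat \<Rightarrow> (nat \<Rightarrow> 'x) \<Rightarrow> nat)
        (g :: nat \<Rightarrow> nat \<Rightarrow> (nat \<Rightarrow> nat) \<Rightarrow> (nat \<Rightarrow> 'y) \<Rightarrow> 'xh)
        (z :: nat \<Rightarrow> (nat \<Rightarrow> 'x) \<Rightarrow> bool list)
        (gd :: nat \<Rightarrow> (nat \<Rightarrow> 'y) \<Rightarrow> bool list \<Rightarrow> (nat \<Rightarrow> nat)).
        finite (set_pmf \<kappa>) \<and>
        (\<exists>M. \<forall>t k x. e t k x < M) \<and>
        (\<forall>t k x x'. (\<forall>i\<le>t. x i = x' i) \<longrightarrow> e t k x = e t k x') \<and>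
        (\<forall>t k s s' y y'. (\<forall>i\<le>t. s i = s' i \<and> y i = y' i) \<longrightarrow> g t k s y = g t k s' y') \<and>
        (let \<mu> = pair_pmf \<kappa> (src_n (src Px Py Pw) n);
             K = (\<lambda>\<omega>. fst \<omega>);
             X = (\<lambda>\<omega> t. fst (snd \<omega> t));
             Y = (\<lambda>\<omega> t. fst (snd (snd \<omega> t)));
             W = (\<lambda>\<omega> t. snd (snd (snd \<omega> t)));
             S = (\<lambda>\<omega> t. if t < n then e t (K \<omega>) (X \<omega>) else 0);
             Xh = (\<lambda>\<omega> t. g t (K \<omega>) (S \<omega>) (Y \<omega>));
             Z = (\<lambda>\<omega>. z (K \<omega>) (X \<omega>))
         in measure_pmf.prob \<mu> {\<omega>. S \<omega> \<noteq> gd (K \<omega>) (Y \<omega>) (Z \<omega>)} < \<epsilon> \<and>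
            ent \<mu> Z / n \<le> R + \<epsilon> \<and>
            ent \<mu> K / n \<le> Rk + \<epsilon> \<and>
            (\<Sum>t<n. measure_pmf.expectation \<mu> (\<lambda>\<omega>. d (X \<omega> t) (Xh \<omega> t))) / n \<le> D + \<epsilon> \<and>
            cond_ent \<mu> X (\<lambda>\<omega>. (W \<omega>, Z \<omega>)) / n \<ge> h - \<epsilon>))"

end

theory Submission
  imports Defs
begin

text \<open>
  Converse. Given the key and the past of the source, the message \<open>S_t\<close> is a function of the fresh letter
  \<open>X_t\<close>, and the reproduction is a function of \<open>S_t\<close> and \<open>Y_t\<close>; hence each letter contributes at least
  \<open>r_c(D_t)\<close> to \<open>H(S^n | K, Y^n, W^n)\<close>, and a supporting line of a convex minorant of \<open>r_c\<close> turns the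
  average into a bound at the average distortion. Fano's inequality transfers the bound to
  \<open>H(Z | K, Y^n, W^n)\<close>, which is at most \<open>H(Z)\<close>. Since \<open>Z\<close> is a function of \<open>(K, X^n)\<close>, one also has
  \<open>H(X^n | W^n, Z) \<le> H(X^n | W^n) + H(K) - H(Z | K, Y^n, W^n)\<close>. Conditioning on \<open>W^n\<close> in addition to \<open>Y^n\<close>
  costs nothing, because the Markov chain makes \<open>H(f(X) | Y, W) = H(f(X) | Y)\<close>.

  Achievability. A point of the convex envelope is approached by time sharing between symbolwise coders
  \<open>f_t\<close>. The messages \<open>S_t = f_t(X_t)\<close> are binned at rate \<open>H(S | Y)\<close> so that the side information \<open>Y^n\<close>
  resolves the bin, and as many bits of the bin index as the key rate permits are encrypted by a
  one-time pad; only the remaining bits reduce the equivocation.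
\<close>

subsection \<open>Entropy of finitely supported distributions\<close>

text \<open>The obstacle in the converse is that message and reproduction at time t depend on the
  key and on the whole past. Conditioning on that past, side information included, only lowers the
  entropy of the message and leaves a symbolwise coder. The envelope is a supremum of real convex
  minorants and may be infinite: the converse treats one minorant at a time, while achievability
  uses a single one, obtained by penalising excess distortion over the convex hull of the
  (distortion, rate) pairs of symbolwise coders. Existence arguments are deterministic: time sharing
  follows one fixed sequence that serves every block length, so convex weights are never rounded,
  and binning is a greedy colouring. Equivocation is obtained by counting: source block and
  ciphertext together reveal the pad, which adds its m bits to H(X^n, W^n, Z), while Z has entropy
  at most its length L. How much the bin index tells Eve never has to be estimated.\<close>

definition hent :: "'a pmf \<Rightarrow> real" where
  "hent p = measure_pmf.expectation p (\<lambda>x. - log 2 (pmf p x))"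

lemma expectation_finite_support:
  fixes f :: "'a \<Rightarrow> real"
  assumes "finite (set_pmf p)"
  shows "measure_pmf.expectation p f = (\<Sum>x\<in>set_pmf p. pmf p x * f x)"
  using assms by (subst integral_measure_pmf[of "set_pmf p"]) auto

lemma expectation_mono_finite_support:
  fixes f g :: "'a \<Rightarrow> real"
  assumes "finite (set_pmf p)" "\<And>x. x \<in> set_pmf p \<Longrightarrow> f x \<le> g x"
  shows "measure_pmf.expectation p f \<le> measure_pmf.expectation p g"
  using assms by (simp add: expectation_finite_support sum_mono mult_left_mono)

lemma expectation_cong_support:
  fixes f g :: "'a \<Rightarrow> real"
  assumes "\<And>x. x \<in> set_pmf p \<Longrightarrow> f x = g x"
  shows "measure_pmf.expectation p f = measure_pmf.expectation p g"
  using assms by (intro integral_cong_AE) (auto simp: AE_measure_pmf_iff)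

text \<open>\<open>hent\<close> depends on the law alone, so every later change of sample space
  reduces to an equality of pushforward laws.\<close>

lemma ent_eq_hent:
  assumes "finite (set_pmf \<mu>)"
  shows "ent \<mu> f = hent (map_pmf f \<mu>)"
  using assms unfolding ent_def hent_def
  by (subst expectation_finite_support) (auto simp: pmf_map)

lemma ent_eq_expectation:
  assumes "finite (set_pmf \<mu>)"
  shows "ent \<mu> f = measure_pmf.expectation \<mu> (\<lambda>\<omega>. - log 2 (pmf (map_pmf f \<mu>) (f \<omega>)))"
  by (simp add: ent_eq_hent[OF assms] hent_def)

lemma ent_map_pmf:
  assumes "finite (set_pmf \<mu>)"
  shows "ent (map_pmf \<phi> \<mu>) f = ent \<mu> (\<lambda>\<omega>. f (\<phi> \<omega>))"
  using assms by (simp add: ent_eq_hent pmf.map_comp o_def)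

text \<open>Gibbs' inequality, from \<open>ln t \<le> t - 1\<close>. The weight \<open>q\<close> may
  be any positive subprobability on the support; strong subadditivity, the cardinality bound and
  Fano's inequality below differ only in the choice of \<open>q\<close>.\<close>

lemma hent_le_cross_entropy:
  assumes fin: "finite (set_pmf p)"
    and pos: "\<And>b. b \<in> set_pmf p \<Longrightarrow> q b > 0"
    and le1: "(\<Sum>b\<in>set_pmf p. q b) \<le> 1"
  shows "hent p \<le> measure_pmf.expectation p (\<lambda>b. - log 2 (q b))"
proof -
  have *: "pmf p b * (- log 2 (pmf p b)) - pmf p b * (- log 2 (q b)) \<le> (q b - pmf p b) / ln 2"
    if b: "b \<in> set_pmf p" for b
  proof -
    have pb: "pmf p b > 0" using b by (simp add: pmf_positive)
    have "ln (q b / pmf p b) \<le> q b / pmf p b - 1"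
      using pb pos[OF b] by (intro ln_le_minus_one) auto
    hence "pmf p b * ln (q b / pmf p b) \<le> pmf p b * (q b / pmf p b - 1)"
      using pb by (intro mult_left_mono) auto
    also have "\<dots> = q b - pmf p b" using pb by (simp add: field_simps)
    finally have "pmf p b * ln (q b / pmf p b) / ln 2 \<le> (q b - pmf p b) / ln 2"
      by (intro divide_right_mono) auto
    thus ?thesis using pb pos[OF b]
      by (simp add: log_def ln_div field_simps)
  qed
  have "hent p - measure_pmf.expectation p (\<lambda>b. - log 2 (q b))
      = (\<Sum>b\<in>set_pmf p. pmf p b * (- log 2 (pmf p b)) - pmf p b * (- log 2 (q b)))"
    unfolding hent_def by (simp add: expectation_finite_support[OF fin] sum_subtractf)
  also have "\<dots> \<le> (\<Sum>b\<in>set_pmf p. (q b - pmf p b) / ln 2)"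
    by (intro sum_mono *)
  also have "\<dots> = ((\<Sum>b\<in>set_pmf p. q b) - (\<Sum>b\<in>set_pmf p. pmf p b)) / ln 2"
    by (simp add: sum_subtractf sum_divide_distrib diff_divide_distrib)
  also have "\<dots> \<le> 0"
    using le1 fin by (simp add: sum_pmf_eq_1 divide_le_0_iff)
  finally show ?thesis by simp
qed

lemma ent_le_cross_entropy:
  assumes fin: "finite (set_pmf \<mu>)"
    and "\<And>\<omega>. \<omega> \<in> set_pmf \<mu> \<Longrightarrow> q (f \<omega>) > 0"
    and "(\<Sum>b\<in>f ` set_pmf \<mu>. q b) \<le> 1"
  shows "ent \<mu> f \<le> measure_pmf.expectation \<mu> (\<lambda>\<omega>. - log 2 (q (f \<omega>)))"
  using hent_le_cross_entropy[of "map_pmf f \<mu>" q] assms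
  by (auto simp: ent_eq_hent)

text \<open>The fibre of \<open>f\<close> contains the fibre of \<open>g\<close> up to null points,
  so self-information is smaller pointwise. Asking for the relation only on the support allows
  default values outside the block to be exploited.\<close>

lemma ent_function_le:
  assumes fin: "finite (set_pmf \<mu>)"
    and fg: "\<And>\<omega>. \<omega> \<in> set_pmf \<mu> \<Longrightarrow> f \<omega> = \<phi> (g \<omega>)"
  shows "ent \<mu> f \<le> ent \<mu> g"
  unfolding ent_eq_expectation[OF fin]
proof (rule expectation_mono_finite_support[OF fin])
  fix \<omega> assume \<omega>: "\<omega> \<in> set_pmf \<mu>"
  have "pmf (map_pmf g \<mu>) (g \<omega>) \<le> pmf (map_pmf f \<mu>) (f \<omega>)"
    unfolding pmf_map using fg \<omega>
    by (intro measure_pmf.finite_measure_mono_AE) (auto simp: AE_measure_pmf_iff)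
  moreover have "pmf (map_pmf g \<mu>) (g \<omega>) > 0"
    using \<omega> by (intro pmf_positive) auto
  ultimately show "- log 2 (pmf (map_pmf f \<mu>) (f \<omega>)) \<le> - log 2 (pmf (map_pmf g \<mu>) (g \<omega>))"
    by simp
qed

lemma ent_eq_if_functions:
  assumes "finite (set_pmf \<mu>)"
    and "\<And>\<omega>. \<omega> \<in> set_pmf \<mu> \<Longrightarrow> f \<omega> = \<phi> (g \<omega>)"
    and "\<And>\<omega>. \<omega> \<in> set_pmf \<mu> \<Longrightarrow> g \<omega> = \<psi> (f \<omega>)"
  shows "ent \<mu> f = ent \<mu> g"
  using assms by (intro antisym ent_function_le[where \<phi> = \<phi>] ent_function_le[where \<phi> = \<psi>])

lemma sum_pmf_fst_marginal:
  assumes fin: "finite (set_pmf \<mu>)" and C: "finite C" "g ` set_pmf \<mu> \<subseteq> C"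
  shows "(\<Sum>c\<in>C. pmf (map_pmf (\<lambda>\<omega>. (f \<omega>, g \<omega>)) \<mu>) (a, c)) = pmf (map_pmf f \<mu>) a"
proof -
  have "(\<Sum>c\<in>C. pmf (map_pmf (\<lambda>\<omega>. (f \<omega>, g \<omega>)) \<mu>) (a, c))
      = measure_pmf.prob \<mu> (\<Union>c\<in>C. (\<lambda>\<omega>. (f \<omega>, g \<omega>)) -` {(a, c)})"
    unfolding pmf_map using C
    by (intro measure_pmf.finite_measure_finite_Union[symmetric]) (auto simp: disjoint_family_on_def)
  also have "\<dots> = measure_pmf.prob \<mu> (f -` {a})"
    using C by (intro measure_pmf.finite_measure_eq_AE) (auto simp: AE_measure_pmf_iff)
  finally show ?thesis by (simp add: pmf_map)
qed

lemma sum_pmf_snd_marginal: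
  assumes fin: "finite (set_pmf \<mu>)" and C: "finite C" "f ` set_pmf \<mu> \<subseteq> C"
  shows "(\<Sum>c\<in>C. pmf (map_pmf (\<lambda>\<omega>. (f \<omega>, g \<omega>)) \<mu>) (c, b)) = pmf (map_pmf g \<mu>) b"
proof -
  have "pmf (map_pmf (\<lambda>\<omega>. (f \<omega>, g \<omega>)) \<mu>) (c, b) = pmf (map_pmf (\<lambda>\<omega>. (g \<omega>, f \<omega>)) \<mu>) (b, c)" for c
    unfolding pmf_map by (intro arg_cong[where f = "measure_pmf.prob \<mu>"]) auto
  thus ?thesis using sum_pmf_fst_marginal[OF assms] by simp
qed

lemma ent_strong_subadditive:
  assumes fin: "finite (set_pmf \<mu>)"
  shows "ent \<mu> (\<lambda>\<omega>. (f \<omega>, g \<omega>, k \<omega>)) + ent \<mu> g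
    \<le> ent \<mu> (\<lambda>\<omega>. (f \<omega>, g \<omega>)) + ent \<mu> (\<lambda>\<omega>. (g \<omega>, k \<omega>))"
proof -
  define P1 where "P1 = pmf (map_pmf (\<lambda>\<omega>. (f \<omega>, g \<omega>)) \<mu>)"
  define P2 where "P2 = pmf (map_pmf (\<lambda>\<omega>. (g \<omega>, k \<omega>)) \<mu>)"
  define P3 where "P3 = pmf (map_pmf g \<mu>)"
  \<comment> \<open>The weights under which \<open>f\<close> and \<open>k\<close> are conditionally
    independent given \<open>g\<close>; cross entropy against them is exactly the right-hand side
    minus \<open>ent \<mu> g\<close>.\<close>
  define q where "q = (\<lambda>(a,b,c). P1 (a,b) * P2 (b,c) / P3 b)"
  let ?A = "f ` set_pmf \<mu>" and ?B = "g ` set_pmf \<mu>" and ?C = "k ` set_pmf \<mu>"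
  have pos: "P1 (f \<omega>, g \<omega>) > 0" "P2 (g \<omega>, k \<omega>) > 0" "P3 (g \<omega>) > 0" if "\<omega> \<in> set_pmf \<mu>" for \<omega>
    using that unfolding P1_def P2_def P3_def by (auto intro!: pmf_positive)
  have q0: "q x \<ge> 0" for x unfolding q_def P1_def P2_def P3_def by (auto split: prod.split)
  have "(\<Sum>x\<in>(\<lambda>\<omega>. (f \<omega>, g \<omega>, k \<omega>)) ` set_pmf \<mu>. q x) \<le> (\<Sum>x\<in>?A \<times> ?B \<times> ?C. q x)"
    using fin q0 by (intro sum_mono2) auto
  also have "\<dots> = (\<Sum>a\<in>?A. \<Sum>b\<in>?B. \<Sum>c\<in>?C. P1 (a,b) * P2 (b,c) / P3 b)"
    by (simp add: sum.cartesian_product q_def case_prod_unfold)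
  also have "\<dots> = (\<Sum>a\<in>?A. \<Sum>b\<in>?B. P1 (a,b) * (\<Sum>c\<in>?C. P2 (b,c)) / P3 b)"
    by (simp add: sum_distrib_left sum_divide_distrib)
  also have "\<dots> = (\<Sum>a\<in>?A. \<Sum>b\<in>?B. P1 (a,b))"
  proof (intro sum.cong refl)
    fix a b assume "b \<in> ?B"
    moreover have "(\<Sum>c\<in>?C. P2 (b,c)) = P3 b"
      unfolding P2_def P3_def using fin by (intro sum_pmf_fst_marginal) auto
    ultimately show "P1 (a,b) * (\<Sum>c\<in>?C. P2 (b,c)) / P3 b = P1 (a,b)"
      using pos by fastforce
  qed
  also have "\<dots> = (\<Sum>a\<in>?A. pmf (map_pmf f \<mu>) a)"
    unfolding P1_def using fin by (intro sum.cong refl sum_pmf_fst_marginal) auto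
  also have "\<dots> \<le> 1" using fin by (simp add: sum_pmf_eq_1)
  finally have "ent \<mu> (\<lambda>\<omega>. (f \<omega>, g \<omega>, k \<omega>))
      \<le> measure_pmf.expectation \<mu> (\<lambda>\<omega>. - log 2 (q (f \<omega>, g \<omega>, k \<omega>)))"
    using pos by (intro ent_le_cross_entropy fin) (auto simp: q_def)
  also have "\<dots> = measure_pmf.expectation \<mu> (\<lambda>\<omega>. - log 2 (P1 (f \<omega>, g \<omega>))
        + - log 2 (P2 (g \<omega>, k \<omega>)) - - log 2 (P3 (g \<omega>)))"
  proof (rule expectation_cong_support)
    fix \<omega> assume "\<omega> \<in> set_pmf \<mu>"
    from pos[OF this] show "- log 2 (q (f \<omega>, g \<omega>, k \<omega>)) = - log 2 (P1 (f \<omega>, g \<omega>))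
        + - log 2 (P2 (g \<omega>, k \<omega>)) - - log 2 (P3 (g \<omega>))"
      by (simp add: q_def log_mult log_divide)
  qed
  also have "\<dots> = ent \<mu> (\<lambda>\<omega>. (f \<omega>, g \<omega>)) + ent \<mu> (\<lambda>\<omega>. (g \<omega>, k \<omega>)) - ent \<mu> g"
    unfolding ent_eq_expectation[OF fin] P1_def P2_def P3_def
    by (simp only: Bochner_Integration.integral_diff Bochner_Integration.integral_add
        integrable_measure_pmf_finite[OF fin] Bochner_Integration.integrable_add)
  finally show ?thesis by simp
qed

lemma ent_const [simp]: "ent \<mu> (\<lambda>_. c) = 0"
proof -
  have "(\<lambda>_. c) ` set_pmf \<mu> = {c}" using set_pmf_not_empty[of \<mu>] by auto
  moreover have "(\<lambda>_::'a. c) -` {c} = UNIV" by auto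
  ultimately show ?thesis by (simp add: ent_def)
qed

lemma ent_Pair_le:
  assumes fin: "finite (set_pmf \<mu>)"
  shows "ent \<mu> (\<lambda>\<omega>. (f \<omega>, g \<omega>)) \<le> ent \<mu> f + ent \<mu> g"
proof -
  have "ent \<mu> (\<lambda>\<omega>. (f \<omega>, g \<omega>)) \<le> ent \<mu> (\<lambda>\<omega>. (f \<omega>, (), g \<omega>))"
    by (rule ent_function_le[OF fin, where \<phi> = "\<lambda>(a,_,b). (a,b)"]) auto
  also have "\<dots> \<le> ent \<mu> (\<lambda>\<omega>. (f \<omega>, ())) + ent \<mu> (\<lambda>\<omega>. ((), g \<omega>))"
    using ent_strong_subadditive[OF fin, of f "\<lambda>_. ()" g] by simp
  also have "ent \<mu> (\<lambda>\<omega>. (f \<omega>, ())) \<le> ent \<mu> f"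
    by (rule ent_function_le[OF fin, where \<phi> = "\<lambda>a. (a,())"]) auto
  also have "ent \<mu> (\<lambda>\<omega>. ((), g \<omega>)) \<le> ent \<mu> g"
    by (rule ent_function_le[OF fin, where \<phi> = "\<lambda>a. ((),a)"]) auto
  finally show ?thesis by simp
qed

lemma cond_ent_nonneg:
  assumes fin: "finite (set_pmf \<mu>)"
  shows "0 \<le> cond_ent \<mu> f g"
  unfolding cond_ent_def using ent_function_le[OF fin, of g snd "\<lambda>\<omega>. (f \<omega>, g \<omega>)"] by simp

lemma ent_le_log_card:
  assumes fin: "finite (set_pmf \<mu>)" and C: "finite C" "f ` set_pmf \<mu> \<subseteq> C"
  shows "ent \<mu> f \<le> log 2 (card C)"
proof -
  have "C \<noteq> {}" using C set_pmf_not_empty[of \<mu>] by blast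
  hence card: "card C > 0" using C by (simp add: card_gt_0_iff)
  have "(\<Sum>b\<in>f ` set_pmf \<mu>. 1 / real (card C)) \<le> 1"
    using card card_mono[OF C] by (simp add: divide_le_eq_1)
  hence "ent \<mu> f \<le> measure_pmf.expectation \<mu> (\<lambda>\<omega>. - log 2 (1 / card C))"
    using card by (intro ent_le_cross_entropy fin) auto
  thus ?thesis using card by (simp add: log_divide)
qed

section \<open>Chain rule and independence\<close>

text \<open>Keeping \<open>a\<close> as first component makes the branches of the mixture disjoint,
  so the joint mass factorises and its logarithm splits.\<close>

lemma hent_bind_Pair:
  assumes finM: "finite (set_pmf M)" and finQ: "\<And>a. a \<in> set_pmf M \<Longrightarrow> finite (set_pmf (Q a))"
  shows "hent (bind_pmf M (\<lambda>a. map_pmf (Pair a) (Q a)))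
    = hent M + measure_pmf.expectation M (\<lambda>a. hent (Q a))"
proof -
  let ?J = "bind_pmf M (\<lambda>a. map_pmf (Pair a) (Q a))"
  have pmfJ: "pmf ?J (a, b) = pmf M a * pmf (Q a) b" for a b
  proof -
    have "pmf (map_pmf (Pair a') (Q a')) (a, b) = indicator {a} a' * pmf (Q a) b" for a'
    proof (cases "a' = a")
      case True
      thus ?thesis using pmf_map_inj'[of "Pair a" "Q a" b] by (simp add: inj_def)
    next
      case False
      hence "(a, b) \<notin> set_pmf (map_pmf (Pair a') (Q a'))" by auto
      thus ?thesis using False by (simp only: set_pmf_iff) simp
    qed
    thus ?thesis by (simp add: pmf_bind measure_pmf_single)
  qed
  have "hent ?J = (\<Sum>a\<in>set_pmf M. pmf M a * measure_pmf.expectation (map_pmf (Pair a) (Q a)) (\<lambda>x. - log 2 (pmf ?J x)))"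
    unfolding hent_def
    by (subst pmf_expectation_bind[where A = "set_pmf M"]) (use finM finQ in auto)
  also have "\<dots> = (\<Sum>a\<in>set_pmf M. pmf M a * (- log 2 (pmf M a) + hent (Q a)))"
  proof (intro sum.cong refl)
    fix a assume a: "a \<in> set_pmf M"
    have "measure_pmf.expectation (map_pmf (Pair a) (Q a)) (\<lambda>x. - log 2 (pmf ?J x))
        = measure_pmf.expectation (Q a) (\<lambda>b. - log 2 (pmf M a) + - log 2 (pmf (Q a) b))"
      unfolding integral_map_pmf
      using a by (intro expectation_cong_support) (auto simp: pmfJ log_mult set_pmf_iff)
    also have "\<dots> = - log 2 (pmf M a) + hent (Q a)"
      unfolding hent_def
      by (subst Bochner_Integration.integral_add)
        (use finQ[OF a] in \<open>auto intro: integrable_measure_pmf_finite\<close>)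
    finally show "pmf M a * measure_pmf.expectation (map_pmf (Pair a) (Q a)) (\<lambda>x. - log 2 (pmf ?J x))
       = pmf M a * (- log 2 (pmf M a) + hent (Q a))" by simp
  qed
  also have "\<dots> = hent M + measure_pmf.expectation M (\<lambda>a. hent (Q a))"
    unfolding hent_def[of M]
    by (simp add: expectation_finite_support[OF finM] distrib_left sum.distrib right_diff_distrib sum_negf sum_subtractf)
  finally show ?thesis .
qed

text \<open>The chain rule for a product law. Later the first component is the key with the past,
  and the second a fresh letter.\<close>

lemma ent_pair_pmf:
  assumes finM: "finite (set_pmf M)" and finP: "finite (set_pmf P)"
  shows "ent (pair_pmf M P) (\<lambda>\<omega>. (fst \<omega>, v (fst \<omega>) (snd \<omega>)))
    = ent M (\<lambda>a. a) + measure_pmf.expectation M (\<lambda>a. ent P (v a))"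
proof -
  have "map_pmf (\<lambda>\<omega>. (fst \<omega>, v (fst \<omega>) (snd \<omega>))) (pair_pmf M P)
      = bind_pmf M (\<lambda>a. map_pmf (Pair a) (map_pmf (v a) P))"
    by (simp add: pair_pmf_def map_bind_pmf map_pmf_def bind_assoc_pmf bind_return_pmf)
  thus ?thesis
    using assms hent_bind_Pair[of M "\<lambda>a. map_pmf (v a) P"] by (simp add: ent_eq_hent)
qed

lemma ent_pair_pmf_indep:
  assumes finM: "finite (set_pmf M)" and finP: "finite (set_pmf P)"
  shows "ent (pair_pmf M P) (\<lambda>\<omega>. (u (fst \<omega>), v (snd \<omega>))) = ent M u + ent P v"
proof -
  have "ent (pair_pmf M P) (\<lambda>\<omega>. (u (fst \<omega>), v (snd \<omega>)))
      = ent (map_pmf (map_prod u v) (pair_pmf M P)) (\<lambda>\<omega>. (fst \<omega>, snd \<omega>))"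
    using assms by (subst ent_map_pmf) auto
  also have "map_pmf (map_prod u v) (pair_pmf M P) = pair_pmf (map_pmf u M) (map_pmf v P)"
    by (simp add: map_pair map_prod_def)
  also have "ent \<dots> (\<lambda>\<omega>. (fst \<omega>, snd \<omega>)) = ent M u + ent P v"
    using assms by (subst ent_pair_pmf) (auto simp: ent_map_pmf)
  finally show ?thesis .
qed

subsection \<open>Causal functions of an i.i.d. source\<close>

lemma expectation_pair_pmf:
  fixes f :: "'a \<times> 'b \<Rightarrow> real"
  assumes "finite (set_pmf M)" "finite (set_pmf P)"
  shows "measure_pmf.expectation (pair_pmf M P) f
    = measure_pmf.expectation M (\<lambda>a. measure_pmf.expectation P (\<lambda>x. f (a, x)))"
proof -
  have "pair_pmf M P = bind_pmf M (\<lambda>a. map_pmf (Pair a) P)"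
    by (simp add: pair_pmf_def map_pmf_def)
  thus ?thesis
    using assms by (simp add: pmf_expectation_bind[where A = "set_pmf M"]
        expectation_finite_support[of M])
qed

lemma finite_set_Pi_pmf:
  assumes "finite A" "\<And>x. x \<in> A \<Longrightarrow> finite (set_pmf (p x))"
  shows "finite (set_pmf (Pi_pmf A dflt p))"
  using assms by (subst set_Pi_pmf) auto

lemma set_Pi_pmf_dflt:
  assumes "f \<in> set_pmf (Pi_pmf A dflt p)" "finite A" "x \<notin> A"
  shows "f x = dflt"
  using set_Pi_pmf_subset[OF assms(2), of dflt p] assms by auto

lemma Pi_pmf_lessThan_Suc:
  "Pi_pmf {..<Suc n} dflt p = map_pmf (\<lambda>(f, y). f(n := y)) (pair_pmf (Pi_pmf {..<n} dflt p) (p n))"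
proof -
  have "Pi_pmf {..<Suc n} dflt p = map_pmf (\<lambda>(y,f). f(n:=y)) (pair_pmf (p n) (Pi_pmf {..<n} dflt p))"
    by (simp add: lessThan_Suc Pi_pmf_insert)
  also have "pair_pmf (p n) (Pi_pmf {..<n} dflt p)
      = map_pmf (\<lambda>(x, y). (y, x)) (pair_pmf (Pi_pmf {..<n} dflt p) (p n))"
    by (rule pair_commute_pmf)
  finally show ?thesis by (auto simp: pmf.map_comp o_def intro!: map_pmf_cong)
qed

lemma ent_iid:
  assumes fin: "finite (set_pmf P)"
  shows "ent (Pi_pmf {..<n} dflt (\<lambda>_. P)) (\<lambda>\<omega> t. \<phi> (\<omega> t)) = real n * ent P \<phi>"
proof (induction n)
  case 0
  show ?case by (simp add: ent_def)
next
  case (Suc n)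
  let ?M = "Pi_pmf {..<n} dflt (\<lambda>_. P)"
  have finM: "finite (set_pmf ?M)" using fin by (intro finite_set_Pi_pmf) auto
  have finp: "finite (set_pmf (pair_pmf ?M P))" using fin finM by simp
  have "ent (Pi_pmf {..<Suc n} dflt (\<lambda>_. P)) (\<lambda>\<omega> t. \<phi> (\<omega> t))
      = ent (pair_pmf ?M P) (\<lambda>\<omega> t. \<phi> (((fst \<omega>)(n := snd \<omega>)) t))"
    by (subst Pi_pmf_lessThan_Suc, subst ent_map_pmf[OF finp]) (simp add: case_prod_unfold)
  also have "\<dots> = ent (pair_pmf ?M P) (\<lambda>\<omega>. (\<lambda>t. \<phi> (fst \<omega> t), \<phi> (snd \<omega>)))"
  proof (rule ent_eq_if_functions[OF finp, where \<phi> = "\<lambda>(F, a). F(n := a)"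
        and \<psi> = "\<lambda>F. (F(n := \<phi> dflt), F n)"])
    \<comment> \<open>On the support, coordinate \<open>n\<close> of the shorter block still has its
      default value, so resetting it undoes the update.\<close>
    fix \<omega> assume "\<omega> \<in> set_pmf (pair_pmf ?M P)"
    hence "fst \<omega> \<in> set_pmf ?M" by auto
    hence "fst \<omega> n = dflt" by (rule set_Pi_pmf_dflt) auto
    thus "(\<lambda>t. \<phi> (fst \<omega> t), \<phi> (snd \<omega>)) = (case \<lambda>t. \<phi> (((fst \<omega>)(n := snd \<omega>)) t) of F \<Rightarrow> (F(n := \<phi> dflt), F n))"
      by (auto simp: fun_eq_iff)
  qed (auto simp: fun_eq_iff)
  also have "\<dots> = ent ?M (\<lambda>\<omega> t. \<phi> (\<omega> t)) + ent P \<phi>"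
    using ent_pair_pmf_indep[OF finM fin, of "\<lambda>\<omega> t. \<phi> (\<omega> t)" \<phi>] by simp
  finally show ?case using Suc.IH by (simp add: algebra_simps)
qed

text \<open>The strict past as a total function. Filling with the default of \<open>Pi_pmf\<close>
  makes it distributed as a shorter i.i.d. block.\<close>

abbreviation prefix_fun :: "nat \<Rightarrow> 'a \<Rightarrow> (nat \<Rightarrow> 'a) \<Rightarrow> nat \<Rightarrow> 'a" where
  "prefix_fun t dflt f \<equiv> (\<lambda>x. if x \<in> {..<t} then f x else dflt)"

lemma map_prefix_letter_iid:
  assumes "t < n"
  shows "map_pmf (\<lambda>\<omega>. (prefix_fun t dflt \<omega>, \<omega> t)) (Pi_pmf {..<n} dflt (\<lambda>_. P))
    = pair_pmf (Pi_pmf {..<t} dflt (\<lambda>_. P)) P"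
proof -
  let ?M = "Pi_pmf {..<t} dflt (\<lambda>_. P)"
  have "map_pmf (\<lambda>\<omega>. (prefix_fun t dflt \<omega>, \<omega> t)) (Pi_pmf {..<n} dflt (\<lambda>_. P))
     = map_pmf (\<lambda>\<omega>. (prefix_fun t dflt \<omega>, \<omega> t)) (Pi_pmf {..<Suc t} dflt (\<lambda>_. P))"
    using assms
    by (subst Pi_pmf_subset[of "{..<n}" "{..<Suc t}" dflt])
      (auto simp: pmf.map_comp o_def intro!: map_pmf_cong)
  also have "\<dots> = map_pmf (\<lambda>\<omega>. \<omega>) (pair_pmf ?M P)"
    unfolding Pi_pmf_lessThan_Suc pmf.map_comp o_def case_prod_unfold
  proof (rule map_pmf_cong[OF refl])
    fix \<omega> assume "\<omega> \<in> set_pmf (pair_pmf ?M P)"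
    hence "fst \<omega> \<in> set_pmf ?M" by auto
    hence "fst \<omega> x = dflt" if "x \<notin> {..<t}" for x using that by (intro set_Pi_pmf_dflt) auto
    thus "(prefix_fun t dflt ((fst \<omega>)(t := snd \<omega>)), ((fst \<omega>)(t := snd \<omega>)) t) = \<omega>"
      by (auto simp: fun_eq_iff prod_eq_iff)
  qed
  finally show ?thesis by simp
qed

text \<open>The current letter is independent of key and strict past together; this is the grouping
  to which \<open>ent_pair_pmf\<close> applies.\<close>

lemma map_key_prefix_letter:
  assumes "t < n"
  shows "map_pmf (\<lambda>\<omega>. ((fst \<omega>, prefix_fun t dflt (snd \<omega>)), snd \<omega> t))
      (pair_pmf \<kappa> (Pi_pmf {..<n} dflt (\<lambda>_. P)))
    = pair_pmf (pair_pmf \<kappa> (Pi_pmf {..<t} dflt (\<lambda>_. P))) P" (is "?L = ?R")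
proof -
  let ?M = "Pi_pmf {..<t} dflt (\<lambda>_. P)"
  have "pair_pmf \<kappa> (pair_pmf ?M P)
     = map_pmf (\<lambda>(k, \<omega>). (k, prefix_fun t dflt \<omega>, \<omega> t)) (pair_pmf \<kappa> (Pi_pmf {..<n} dflt (\<lambda>_. P)))"
    unfolding map_prefix_letter_iid[OF assms, symmetric]
    using map_pair[of "\<lambda>k. k" "\<lambda>\<omega>. (prefix_fun t dflt \<omega>, \<omega> t)" \<kappa>] by simp
  hence "?L = map_pmf (\<lambda>(k, \<tau>, x). ((k, \<tau>), x)) (pair_pmf \<kappa> (pair_pmf ?M P))"
    by (simp add: pmf.map_comp o_def case_prod_unfold)
  also have "\<dots> = ?R"
    by (simp add: pair_pmf_def map_bind_pmf map_pmf_def bind_assoc_pmf bind_return_pmf)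
  finally show ?thesis .
qed

text \<open>Time \<open>t\<close> itself may be read, the future not. The instances are the message
  with the side information attached, and the distortion of a letter.\<close>

definition causal :: "(nat \<Rightarrow> 'k \<Rightarrow> (nat \<Rightarrow> 'a) \<Rightarrow> 'b) \<Rightarrow> bool" where
  "causal \<sigma> \<longleftrightarrow> (\<forall>t k \<omega> \<omega>'. (\<forall>i\<le>t. \<omega> i = \<omega>' i) \<longrightarrow> \<sigma> t k \<omega> = \<sigma> t k \<omega>')"

lemma causal_upd_prefix:
  assumes "causal \<sigma>"
  shows "\<sigma> t k ((prefix_fun t dflt \<omega>)(t := x)) = \<sigma> t k ((\<omega>)(t := x))"
proof -
  have "\<forall>i\<le>t. ((prefix_fun t dflt \<omega>)(t := x)) i = ((\<omega>)(t := x)) i" by auto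
  thus ?thesis using assms unfolding causal_def by blast
qed

text \<open>Moves an average over the past to the common sample space of the whole block, so that
  terms for different times can be added.\<close>

lemma expectation_prefix:
  fixes G :: "'k \<times> (nat \<Rightarrow> 'a) \<Rightarrow> real"
  assumes "t < n"
  shows "measure_pmf.expectation (pair_pmf \<kappa> (Pi_pmf {..<t} dflt (\<lambda>_. P))) G
    = measure_pmf.expectation (pair_pmf \<kappa> (Pi_pmf {..<n} dflt (\<lambda>_. P)))
        (\<lambda>\<omega>. G (fst \<omega>, prefix_fun t dflt (snd \<omega>)))"
proof -
  have "pair_pmf \<kappa> (Pi_pmf {..<t} dflt (\<lambda>_. P))
    = map_pmf fst (pair_pmf (pair_pmf \<kappa> (Pi_pmf {..<t} dflt (\<lambda>_. P))) P)"
    by (simp add: map_fst_pair_pmf)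
  also have "\<dots> = map_pmf (\<lambda>\<omega>. (fst \<omega>, prefix_fun t dflt (snd \<omega>))) (pair_pmf \<kappa> (Pi_pmf {..<n} dflt (\<lambda>_. P)))"
    unfolding map_key_prefix_letter[OF assms, symmetric] by (simp add: pmf.map_comp o_def)
  finally show ?thesis by simp
qed

text \<open>Resampling: the letter at time \<open>t\<close> is independent of key and strict past,
  so a fresh copy may replace it; later coordinates have no influence by causality.\<close>

lemma expectation_causal:
  fixes \<delta> :: "nat \<Rightarrow> 'k \<Rightarrow> (nat \<Rightarrow> 'a) \<Rightarrow> real" and dflt :: 'a
  assumes "causal \<delta>" and t: "t < n" and fin: "finite (set_pmf \<kappa>)" "finite (set_pmf P)"
  defines "\<mu> \<equiv> pair_pmf \<kappa> (Pi_pmf {..<n} dflt (\<lambda>_. P))"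
  shows "measure_pmf.expectation \<mu> (\<lambda>\<omega>. \<delta> t (fst \<omega>) (snd \<omega>))
    = measure_pmf.expectation \<mu> (\<lambda>\<omega>. measure_pmf.expectation P (\<lambda>x. \<delta> t (fst \<omega>) ((snd \<omega>)(t := x))))"
proof -
  let ?M = "pair_pmf \<kappa> (Pi_pmf {..<t} dflt (\<lambda>_. P))"
  have finM: "finite (set_pmf ?M)" using fin by (auto intro!: finite_set_Pi_pmf)
  have "measure_pmf.expectation \<mu> (\<lambda>\<omega>. \<delta> t (fst \<omega>) (snd \<omega>))
    = measure_pmf.expectation \<mu> (\<lambda>\<omega>. \<delta> t (fst \<omega>) ((prefix_fun t dflt (snd \<omega>))(t := snd \<omega> t)))"
    by (simp only: causal_upd_prefix[OF assms(1)] fun_upd_triv)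
  also have "\<dots> = measure_pmf.expectation (map_pmf (\<lambda>\<omega>. ((fst \<omega>, prefix_fun t dflt (snd \<omega>)), snd \<omega> t)) \<mu>)
      (\<lambda>((k, \<tau>), x). \<delta> t k (\<tau>(t := x)))"
    by simp
  also have "\<dots> = measure_pmf.expectation ?M (\<lambda>(k, \<tau>). measure_pmf.expectation P (\<lambda>x. \<delta> t k (\<tau>(t := x))))"
    unfolding \<mu>_def map_key_prefix_letter[OF t]
    by (subst expectation_pair_pmf[OF finM fin(2)]) (simp add: case_prod_unfold)
  also have "\<dots> = measure_pmf.expectation \<mu> (\<lambda>\<omega>. measure_pmf.expectation P (\<lambda>x. \<delta> t (fst \<omega>) ((snd \<omega>)(t := x))))"
    unfolding expectation_prefix[OF t] \<mu>_def prod.case causal_upd_prefix[OF assms(1)] ..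
  finally show ?thesis .
qed

text \<open>Conditioning each letter on the whole source past, which determines the past letters, makes it
  a function of a fresh source letter.\<close>
lemma ent_causal_ge:
  fixes \<sigma> :: "nat \<Rightarrow> 'k \<Rightarrow> (nat \<Rightarrow> 'a) \<Rightarrow> 'b" and dflt :: 'a and n :: nat
  assumes causal: "causal \<sigma>" and fin: "finite (set_pmf \<kappa>)" "finite (set_pmf P)"
  defines "\<mu> \<equiv> pair_pmf \<kappa> (Pi_pmf {..<n} dflt (\<lambda>_. P))"
  shows "ent \<kappa> (\<lambda>k. k) + (\<Sum>t<n. measure_pmf.expectation \<mu> (\<lambda>\<omega>. ent P (\<lambda>x. \<sigma> t (fst \<omega>) ((snd \<omega>)(t := x)))))
    \<le> ent \<mu> (\<lambda>\<omega>. (fst \<omega>, \<lambda>t. if t < n then \<sigma> t (fst \<omega>) (snd \<omega>) else c))"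
proof -
  define A where "A = (\<lambda>j \<omega>. (fst \<omega> :: 'k, \<lambda>t. if t < j then \<sigma> t (fst \<omega>) (snd \<omega>) else c))"
  have fin\<mu>: "finite (set_pmf \<mu>)" unfolding \<mu>_def using fin by (auto intro!: finite_set_Pi_pmf)
  have "ent \<kappa> (\<lambda>k. k) + (\<Sum>t<j. measure_pmf.expectation \<mu> (\<lambda>\<omega>. ent P (\<lambda>x. \<sigma> t (fst \<omega>) ((snd \<omega>)(t := x)))))
    \<le> ent \<mu> (A j)" if "j \<le> n" for j
    using that
  proof (induction j)
    case 0
    have "ent \<kappa> (\<lambda>k. k) = ent (map_pmf fst \<mu>) (\<lambda>k. k)" by (simp add: \<mu>_def map_fst_pair_pmf)
    also have "\<dots> = ent \<mu> fst" by (subst ent_map_pmf[OF fin\<mu>]) simp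
    also have "\<dots> \<le> ent \<mu> (A 0)" by (rule ent_function_le[OF fin\<mu>, where \<phi> = fst]) (simp add: A_def)
    finally show ?case by simp
  next
    case (Suc j)
    hence j: "j < n" by simp
    let ?M = "pair_pmf \<kappa> (Pi_pmf {..<j} dflt (\<lambda>_. P))"
    have finM: "finite (set_pmf ?M)" using fin by (auto intro!: finite_set_Pi_pmf)
    define T where "T = (\<lambda>\<omega>. (fst \<omega> :: 'k, prefix_fun j dflt (snd \<omega>)))"
    define s where "s = (\<lambda>\<omega>. \<sigma> j (fst \<omega>) (snd \<omega>))"
    have s_eq: "s \<omega> = \<sigma> j (fst (T \<omega>)) ((snd (T \<omega>))(j := snd \<omega> j))" for \<omega>
      unfolding s_def T_def fst_conv snd_conv causal_upd_prefix[OF causal] by simp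
    have A_T: "A j \<omega> = A j (T \<omega>)" for \<omega>
    proof -
      have "\<sigma> t (fst \<omega>) (snd \<omega>) = \<sigma> t (fst \<omega>) (prefix_fun j dflt (snd \<omega>))" if "t < j" for t
        using that by (intro causal[unfolded causal_def, rule_format]) auto
      thus ?thesis unfolding A_def T_def by (auto simp: fun_eq_iff)
    qed
    \<comment> \<open>With A for \<open>A j\<close>: H(s | A) \<ge> H(s | A, T) = H(s | T), because
      \<open>T\<close> determines A; the last term is the entropy of a function of a fresh
      letter.\<close>
    have "ent \<mu> (\<lambda>\<omega>. (T \<omega>, s \<omega>)) \<le> ent \<mu> (\<lambda>\<omega>. (s \<omega>, A j \<omega>, T \<omega>))"
      by (rule ent_function_le[OF fin\<mu>, where \<phi> = "\<lambda>(a,b,c). (c,a)"]) simp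
    moreover have "ent \<mu> (\<lambda>\<omega>. (s \<omega>, A j \<omega>, T \<omega>)) + ent \<mu> (A j)
        \<le> ent \<mu> (\<lambda>\<omega>. (s \<omega>, A j \<omega>)) + ent \<mu> (\<lambda>\<omega>. (A j \<omega>, T \<omega>))"
      by (rule ent_strong_subadditive[OF fin\<mu>])
    moreover have "ent \<mu> (\<lambda>\<omega>. (A j \<omega>, T \<omega>)) \<le> ent \<mu> T"
      by (rule ent_function_le[OF fin\<mu>, where \<phi> = "\<lambda>b. (A j b, b)"]) (simp add: A_T[symmetric])
    moreover have "ent \<mu> (\<lambda>\<omega>. (s \<omega>, A j \<omega>)) \<le> ent \<mu> (A (Suc j))"
      by (rule ent_function_le[OF fin\<mu>, where \<phi> = "\<lambda>(k, F). (F j, (k, F(j := c)))"])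
        (auto simp: A_def s_def fun_eq_iff)
    moreover have "ent \<mu> (\<lambda>\<omega>. (T \<omega>, s \<omega>)) = ent \<mu> T
        + measure_pmf.expectation \<mu> (\<lambda>\<omega>. ent P (\<lambda>x. \<sigma> j (fst \<omega>) ((snd \<omega>)(j := x))))"
    proof -
      have law: "map_pmf (\<lambda>\<omega>. (T \<omega>, snd \<omega> j)) \<mu> = pair_pmf ?M P"
        unfolding \<mu>_def T_def by (rule map_key_prefix_letter[OF j])
      have "ent \<mu> (\<lambda>\<omega>. (T \<omega>, s \<omega>)) = ent (map_pmf (\<lambda>\<omega>. (T \<omega>, snd \<omega> j)) \<mu>)
          (\<lambda>\<omega>. (fst \<omega>, \<sigma> j (fst (fst \<omega>)) ((snd (fst \<omega>))(j := snd \<omega>))))"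
        by (subst ent_map_pmf[OF fin\<mu>]) (simp only: s_eq fst_conv snd_conv)
      also have "\<dots> = ent ?M (\<lambda>a. a)
          + measure_pmf.expectation ?M (\<lambda>a. ent P (\<lambda>x. \<sigma> j (fst a) ((snd a)(j := x))))"
        unfolding law
        using ent_pair_pmf[OF finM fin(2), of "\<lambda>a x. \<sigma> j (fst a) ((snd a)(j := x))"] by simp
      also have "ent ?M (\<lambda>a. a) = ent (map_pmf fst (map_pmf (\<lambda>\<omega>. (T \<omega>, snd \<omega> j)) \<mu>)) (\<lambda>a. a)"
        unfolding law by (simp add: map_fst_pair_pmf)
      also have "\<dots> = ent \<mu> T"
        by (simp add: pmf.map_comp o_def ent_map_pmf fin\<mu>)
      also have "measure_pmf.expectation ?M (\<lambda>a. ent P (\<lambda>x. \<sigma> j (fst a) ((snd a)(j := x))))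
          = measure_pmf.expectation \<mu> (\<lambda>\<omega>. ent P (\<lambda>x. \<sigma> j (fst \<omega>) ((snd \<omega>)(j := x))))"
        unfolding expectation_prefix[OF j] \<mu>_def fst_conv snd_conv causal_upd_prefix[OF causal] ..
      finally show ?thesis .
    qed
    ultimately show ?case
      using Suc.IH[OF less_imp_le[OF j]] unfolding sum.lessThan_Suc by linarith
  qed
  from this[of n] show ?thesis unfolding A_def by simp
qed

subsection \<open>Converse\<close>

text \<open>\<open>w\<close> is drawn from \<open>Pw y\<close> alone and \<open>r\<close> recovers
  \<open>y\<close> from \<open>u x y\<close>, so \<open>w\<close> adds the mean entropy of
  \<open>Pw y\<close> whatever else \<open>u\<close> contains.\<close>

lemma ent_src_Markov:
  fixes Px :: "'x::finite pmf" and Py :: "'x \<Rightarrow> 'y::finite pmf" and Pw :: "'y \<Rightarrow> 'w::finite pmf"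
  assumes r: "\<And>x y. r (u x y) = y"
  shows "ent (src Px Py Pw) (\<lambda>(x,y,w). (u x y, w))
    = ent (src Px Py Pw) (\<lambda>(x,y,w). u x y) + measure_pmf.expectation (src Px Py Pw) (\<lambda>(x,y,w). hent (Pw y))"
proof -
  let ?P = "src Px Py Pw"
  let ?M = "map_pmf (\<lambda>(x,y,w). u x y) ?P"
  have "map_pmf (\<lambda>(x,y,w). (u x y, w)) ?P = bind_pmf ?M (\<lambda>a. map_pmf (Pair a) (Pw (r a)))"
    by (simp add: src_def map_pmf_def bind_assoc_pmf bind_return_pmf r)
  hence "ent ?P (\<lambda>(x,y,w). (u x y, w)) = hent ?M + measure_pmf.expectation ?M (\<lambda>a. hent (Pw (r a)))"
    by (simp add: ent_eq_hent hent_bind_Pair)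
  thus ?thesis by (simp add: ent_eq_hent r case_prod_unfold)
qed

text \<open>The contribution of \<open>w\<close> is the same with and without \<open>F\<close> and
  cancels, which removes Eve's letter from the conditioning pair \<open>snd p\<close>.\<close>

lemma cond_ent_src_Markov:
  fixes Px :: "'x::finite pmf" and Py :: "'x \<Rightarrow> 'y::finite pmf" and Pw :: "'y \<Rightarrow> 'w::finite pmf"
  shows "ent (src Px Py Pw) (\<lambda>p. (F (fst p), snd p)) - ent (src Px Py Pw) snd
    = cond_ent (src Px Py Pw) (\<lambda>(x,y,w). F x) (\<lambda>(x,y,w). y)"
proof -
  have "ent (src Px Py Pw) (\<lambda>p. (F (fst p), snd p)) = ent (src Px Py Pw) (\<lambda>(x,y,w). ((F x, y), w))"
    by (rule ent_eq_if_functions[where \<phi> = "\<lambda>((a,b),c). (a,b,c)" and \<psi> = "\<lambda>(a,b,c). ((a,b),c)"]) auto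
  moreover have "ent (src Px Py Pw) snd = ent (src Px Py Pw) (\<lambda>(x,y,w). (y, w))"
    by (rule arg_cong[where f = "ent _"]) auto
  ultimately show ?thesis
    using ent_src_Markov[of snd "\<lambda>x y. (F x, y)" Px Py Pw] ent_src_Markov[of id "\<lambda>x y. y" Px Py Pw]
    by (simp add: cond_ent_def case_prod_unfold)
qed

text \<open>The alphabet bound in the definition costs nothing: \<open>F\<close> has at most \<open>CARD('x)\<close> values.\<close>
lemma rc_SI_le:
  fixes Px :: "'x::finite pmf" and Py :: "'x \<Rightarrow> 'y::finite pmf" and Pw :: "'y \<Rightarrow> 'w::finite pmf"
    and d :: "'x \<Rightarrow> 'xh::finite \<Rightarrow> real" and F :: "'x \<Rightarrow> 'b"
  assumes "measure_pmf.expectation (src Px Py Pw) (\<lambda>(x,y,w). d x (G (F x) y)) \<le> D"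
  shows "rc_SI Px Py Pw d D \<le> ereal (cond_ent (src Px Py Pw) (\<lambda>(x,y,w). F x) (\<lambda>(x,y,w). y))"
proof -
  let ?P = "src Px Py Pw"
  have "card (range F) \<le> card {..<CARD('x)}" using card_image_le[of UNIV F] by simp
  then obtain \<rho> where \<rho>: "\<rho> ` range F \<subseteq> {..<CARD('x)}" "inj_on \<rho> (range F)"
    using card_le_inj[of "range F" "{..<CARD('x)}"] by auto
  define G' where "G' = (\<lambda>s y. G (inv_into (range F) \<rho> s) y)"
  have G': "G' (\<rho> (F x)) y = G (F x) y" for x y
    unfolding G'_def using \<rho>(2) by simp
  have "ent ?P (\<lambda>p. (case p of (x,y,w) \<Rightarrow> \<rho> (F x), case p of (x,y,w) \<Rightarrow> y))
      = ent ?P (\<lambda>p. (case p of (x,y,w) \<Rightarrow> F x, case p of (x,y,w) \<Rightarrow> y))"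
    by (rule ent_eq_if_functions[where \<phi> = "\<lambda>(a,b). (\<rho> a, b)" and \<psi> = "\<lambda>(a,b). (inv_into (range F) \<rho> a, b)"])
      (use \<rho>(2) in auto)
  hence "cond_ent ?P (\<lambda>(x,y,w). \<rho> (F x)) (\<lambda>(x,y,w). y) = cond_ent ?P (\<lambda>(x,y,w). F x) (\<lambda>(x,y,w). y)"
    by (simp only: cond_ent_def)
  moreover have "\<forall>x. \<rho> (F x) < CARD('x)" using \<rho>(1) by auto
  moreover have "measure_pmf.expectation ?P (\<lambda>(x,y,w). d x (G' (\<rho> (F x)) y)) \<le> D"
    using assms by (simp add: G')
  ultimately show ?thesis
    unfolding rc_SI_def
    by (intro Inf_lower CollectI exI[of _ "\<lambda>x. \<rho> (F x)"] exI[of _ G'] conjI) auto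
qed

text \<open>The supporting line of \<open>c\<close> is evaluated at the distortion that the coder
  actually attains. Being affine in that distortion, the bound can be averaged over key, past and
  time.\<close>

lemma single_letter_bound:
  fixes c :: "real \<Rightarrow> real" and Px :: "'x::finite pmf" and Py :: "'x \<Rightarrow> 'y::finite pmf" and Pw :: "'y \<Rightarrow> 'w::finite pmf"
    and d :: "'x \<Rightarrow> 'xh::finite \<Rightarrow> real"
  assumes c: "\<And>D'. ereal (c D') \<le> rc_SI Px Py Pw d D'"
    and m: "\<And>D'. c D + m * (D' - D) \<le> c D'"
  shows "ent (src Px Py Pw) snd + c D
      + m * (measure_pmf.expectation (src Px Py Pw) (\<lambda>p. d (fst p) (G (F (fst p)) (fst (snd p)))) - D)
    \<le> ent (src Px Py Pw) (\<lambda>p. (F (fst p), snd p))"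
proof -
  let ?D = "measure_pmf.expectation (src Px Py Pw) (\<lambda>(x,y,w). d x (G (F x) y))"
  have "ereal (c ?D) \<le> ereal (cond_ent (src Px Py Pw) (\<lambda>(x,y,w). F x) (\<lambda>(x,y,w). y))"
    using c rc_SI_le[OF order_refl] by (rule order_trans)
  with m[of ?D] show ?thesis
    unfolding cond_ent_src_Markov[symmetric] by (simp add: case_prod_unfold)
qed

text \<open>The line comes from the right derivative of \<open>c\<close>. Its slope cannot be
  positive because \<open>c\<close> stays bounded to the right: a constant message meets every large
  distortion level. The sign matters since a code is only known to have distortion at most
  \<open>D + \<epsilon>\<close>.\<close>

lemma subgradient_rc_SI:
  fixes Px :: "'x::finite pmf" and Py :: "'x \<Rightarrow> 'y::finite pmf" and Pw :: "'y \<Rightarrow> 'w::finite pmf"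
    and d :: "'x \<Rightarrow> 'xh::finite \<Rightarrow> real"
  assumes cvx: "convex_on UNIV c" and c: "\<And>D'. ereal (c D') \<le> rc_SI Px Py Pw d D'"
  obtains m where "m \<le> 0" "\<And>D'. c D + m * (D' - D) \<le> c D'"
proof -
  define m where "m = Inf ((\<lambda>t. (c D - c t) / (D - t)) ` ({D<..} \<inter> UNIV))"
  have m: "c D + m * (D' - D) \<le> c D'" for D'
    unfolding m_def using convex_le_Inf_differential[OF cvx, of D D'] by simp
  \<comment> \<open>Rate and distortion of the coder with a constant message and the constant
    reproduction \<open>undefined\<close>.\<close>
  define B where "B = cond_ent (src Px Py Pw) (\<lambda>(x,y,w). ()) (\<lambda>(x,y,w). y)"
  define D0 where "D0 = measure_pmf.expectation (src Px Py Pw) (\<lambda>(x,y,w). d x undefined)"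
  have B: "c D' \<le> B" if "D' \<ge> D0" for D'
  proof -
    have "ereal (c D') \<le> ereal B"
      unfolding B_def using that
      by (intro order_trans[OF c[of D'] rc_SI_le[where G = "\<lambda>_ _. undefined"]]) (simp add: D0_def)
    thus ?thesis by simp
  qed
  have "m \<le> 0"
  proof (rule ccontr)
    assume "\<not> m \<le> 0"
    hence mpos: "m > 0" by simp
    \<comment> \<open>Far enough to the right for the line to exceed \<open>B\<close> by at least
      \<open>m\<close>.\<close>
    define D' where "D' = max D0 (D + (B - c D) / m + 1)"
    have "(B - c D) / m + 1 \<le> D' - D" unfolding D'_def by simp
    hence "m * ((B - c D) / m + 1) \<le> m * (D' - D)" using mpos by (intro mult_left_mono) auto
    hence "B - c D + m \<le> m * (D' - D)" using mpos by (simp add: distrib_left)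
    moreover have "c D' \<le> B" by (rule B) (simp add: D'_def)
    ultimately show False using m[of D'] mpos by linarith
  qed
  thus ?thesis using m that by blast
qed

section \<open>Entropy bounds for one fixed causal code\<close>

text \<open>Only causality and a finite key are assumed, no performance, so the locale serves the
  analysis of arbitrary codes as well as of the constructed one.\<close>

locale causal_code =
  fixes Px :: "'x::finite pmf" and Py :: "'x \<Rightarrow> 'y::finite pmf" and Pw :: "'y \<Rightarrow> 'w::finite pmf"
    and d :: "'x \<Rightarrow> 'xh::finite \<Rightarrow> real" and n :: nat
    and \<kappa> :: "nat pmf" and e :: "nat \<Rightarrow> nat \<Rightarrow> (nat \<Rightarrow> 'x) \<Rightarrow> nat"
    and g :: "nat \<Rightarrow> nat \<Rightarrow> (nat \<Rightarrow> nat) \<Rightarrow> (nat \<Rightarrow> 'y) \<Rightarrow> 'xh"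
    and z :: "nat \<Rightarrow> (nat \<Rightarrow> 'x) \<Rightarrow> bool list"
    and gd :: "nat \<Rightarrow> (nat \<Rightarrow> 'y) \<Rightarrow> bool list \<Rightarrow> (nat \<Rightarrow> nat)"
  assumes fin_key: "finite (set_pmf \<kappa>)"
    and causal_e: "(\<forall>i\<le>t. x i = x' i) \<Longrightarrow> e t k x = e t k x'"
    and causal_g: "(\<forall>i\<le>t. s i = s' i \<and> y i = y' i) \<Longrightarrow> g t k s y = g t k s' y'"
begin

abbreviation P where "P \<equiv> src Px Py Pw"

definition \<mu> where "\<mu> = pair_pmf \<kappa> (src_n P n)"

abbreviation K :: "nat \<times> (nat \<Rightarrow> 'x \<times> 'y \<times> 'w) \<Rightarrow> nat" where "K \<equiv> \<lambda>\<omega>. fst \<omega>"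
abbreviation X :: "nat \<times> (nat \<Rightarrow> 'x \<times> 'y \<times> 'w) \<Rightarrow> nat \<Rightarrow> 'x" where "X \<equiv> \<lambda>\<omega> t. fst (snd \<omega> t)"
abbreviation Y :: "nat \<times> (nat \<Rightarrow> 'x \<times> 'y \<times> 'w) \<Rightarrow> nat \<Rightarrow> 'y" where "Y \<equiv> \<lambda>\<omega> t. fst (snd (snd \<omega> t))"
abbreviation W :: "nat \<times> (nat \<Rightarrow> 'x \<times> 'y \<times> 'w) \<Rightarrow> nat \<Rightarrow> 'w" where "W \<equiv> \<lambda>\<omega> t. snd (snd (snd \<omega> t))"
abbreviation V :: "nat \<times> (nat \<Rightarrow> 'x \<times> 'y \<times> 'w) \<Rightarrow> nat \<Rightarrow> 'y \<times> 'w" where "V \<equiv> \<lambda>\<omega> t. snd (snd \<omega> t)"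
abbreviation S :: "nat \<times> (nat \<Rightarrow> 'x \<times> 'y \<times> 'w) \<Rightarrow> nat \<Rightarrow> nat"
  where "S \<equiv> \<lambda>\<omega> t. if t < n then e t (K \<omega>) (X \<omega>) else 0"
abbreviation Xh :: "nat \<times> (nat \<Rightarrow> 'x \<times> 'y \<times> 'w) \<Rightarrow> nat \<Rightarrow> 'xh" where "Xh \<equiv> \<lambda>\<omega> t. g t (K \<omega>) (S \<omega>) (Y \<omega>)"
abbreviation Z :: "nat \<times> (nat \<Rightarrow> 'x \<times> 'y \<times> 'w) \<Rightarrow> bool list" where "Z \<equiv> \<lambda>\<omega>. z (K \<omega>) (X \<omega>)"

lemma fin_src_n: "finite (set_pmf (src_n P n))"
  unfolding src_n_def by (intro finite_set_Pi_pmf) auto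

lemma fin_\<mu>: "finite (set_pmf \<mu>)"
  unfolding \<mu>_def using fin_key fin_src_n by simp

lemma ent_source: "ent \<mu> (\<lambda>\<omega> t. \<phi> (snd \<omega> t)) = n * ent P \<phi>"
proof -
  have "ent \<mu> (\<lambda>\<omega> t. \<phi> (snd \<omega> t)) = ent (map_pmf snd \<mu>) (\<lambda>\<omega> t. \<phi> (\<omega> t))"
    by (simp add: ent_map_pmf fin_\<mu>)
  also have "\<dots> = n * ent P \<phi>"
    by (simp add: \<mu>_def map_snd_pair_pmf src_n_def ent_iid)
  finally show ?thesis .
qed

lemma ent_key_source: "ent \<mu> (\<lambda>\<omega>. (K \<omega>, \<lambda>t. \<phi> (snd \<omega> t))) = ent \<kappa> (\<lambda>k. k) + n * ent P \<phi>"
  using ent_pair_pmf_indep[OF fin_key fin_src_n, of "\<lambda>k. k" "\<lambda>\<omega> t. \<phi> (\<omega> t)"]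
  by (simp add: \<mu>_def src_n_def ent_iid)

lemma ent_key: "ent \<mu> K = ent \<kappa> (\<lambda>k. k)"
  using ent_map_pmf[OF fin_\<mu>, of fst "\<lambda>k. k"] by (simp add: \<mu>_def map_fst_pair_pmf)

lemma ent_XW: "ent \<mu> (\<lambda>\<omega>. (X \<omega>, W \<omega>)) = n * ent P (\<lambda>p. (fst p, snd (snd p)))"
proof -
  have "ent \<mu> (\<lambda>\<omega>. (X \<omega>, W \<omega>)) = ent \<mu> (\<lambda>\<omega> t. (X \<omega> t, W \<omega> t))"
    by (rule ent_eq_if_functions[OF fin_\<mu>, where \<phi> = "\<lambda>F. (\<lambda>t. fst (F t), \<lambda>t. snd (F t))"
        and \<psi> = "\<lambda>(F, G) t. (F t, G t)"]) auto
  also have "\<dots> = n * ent P (\<lambda>p. (fst p, snd (snd p)))"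
    by (rule ent_source[where \<phi> = "\<lambda>p. (fst p, snd (snd p))"])
  finally show ?thesis .
qed

abbreviation H_XW where "H_XW \<equiv> cond_ent P (\<lambda>(x,y,w). x) (\<lambda>(x,y,w). w)"

lemma H_XW_eq: "n * H_XW = ent \<mu> (\<lambda>\<omega>. (X \<omega>, W \<omega>)) - ent \<mu> W"
  using ent_source[where \<phi> = "\<lambda>p. snd (snd p)"]
  by (simp add: ent_XW cond_ent_def case_prod_unfold right_diff_distrib)

definition err where "err = {\<omega>. S \<omega> \<noteq> gd (K \<omega>) (Y \<omega>) (Z \<omega>)}"

text \<open>With weight 1/2 on \<open>None\<close> and 1/2 spread uniformly over source blocks, a
  correct recovery costs one bit and a failure 1 + n log |X| bits. Revealing the source block
  instead of the messages keeps the bound free of the message alphabet, whose size may vary with the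
  code.\<close>

lemma ent_Fano_le:
  "ent \<mu> (\<lambda>\<omega>. if \<omega> \<in> err then Some (X \<omega>) else None)
    \<le> 1 + measure_pmf.prob \<mu> err * (n * log 2 CARD('x))" (is "ent \<mu> ?U \<le> _")
proof -
  define q :: "(nat \<Rightarrow> 'x) option \<Rightarrow> real" where
    "q = (\<lambda>u. case u of None \<Rightarrow> 1/2 | Some _ \<Rightarrow> 1/2 / CARD('x)^n)"
  \<comment> \<open>Outside the block the source takes the value \<open>undefined\<close>, whose
    first component is the default here, so there are |X|^n possible blocks.\<close>
  let ?F = "PiE_dflt {..<n} (fst (undefined :: 'x \<times> 'y \<times> 'w)) (\<lambda>_. UNIV :: 'x set)"
  have "?U ` set_pmf \<mu> \<subseteq> insert None (Some ` ?F)"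
  proof
    fix u assume "u \<in> ?U ` set_pmf \<mu>"
    then obtain \<omega> where \<omega>: "\<omega> \<in> set_pmf \<mu>" "u = ?U \<omega>" by blast
    have "snd \<omega> \<in> set_pmf (Pi_pmf {..<n} undefined (\<lambda>_. P))"
      using \<omega>(1) by (auto simp: \<mu>_def src_n_def)
    hence "snd \<omega> t = undefined" if "t \<notin> {..<n}" for t
      using that by (intro set_Pi_pmf_dflt) auto
    hence "X \<omega> \<in> ?F" by (auto simp: PiE_dflt_def)
    thus "u \<in> insert None (Some ` ?F)" using \<omega>(2) by auto
  qed
  hence "(\<Sum>u\<in>?U ` set_pmf \<mu>. q u) \<le> (\<Sum>u\<in>insert None (Some ` ?F). q u)"
    by (intro sum_mono2) (auto simp: q_def split: option.split intro!: finite_imageI finite_PiE_dflt)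
  also have "\<dots> = 1/2 + (\<Sum>u\<in>?F. 1/2 / CARD('x)^n)"
    by (subst sum.insert) (auto simp: q_def sum.reindex intro!: finite_imageI finite_PiE_dflt)
  also have "\<dots> \<le> 1" by (simp add: card_PiE_dflt)
  finally have "ent \<mu> ?U \<le> measure_pmf.expectation \<mu> (\<lambda>\<omega>. - log 2 (q (?U \<omega>)))"
    by (intro ent_le_cross_entropy fin_\<mu>) (auto simp: q_def)
  also have "\<dots> = measure_pmf.expectation \<mu> (\<lambda>\<omega>. 1 + indicator err \<omega> * (n * log 2 CARD('x)))"
    by (intro expectation_cong_support)
      (auto simp: q_def log_divide log_mult log_nat_power split: split_indicator)
  also have "\<dots> = 1 + measure_pmf.prob \<mu> err * (n * log 2 CARD('x))"
    by (subst Bochner_Integration.integral_add) (auto intro: integrable_measure_pmf_finite fin_\<mu>)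
  finally show ?thesis .
qed

lemma ent_SKV_le:
  "ent \<mu> (\<lambda>\<omega>. (S \<omega>, K \<omega>, V \<omega>))
    \<le> ent \<mu> (\<lambda>\<omega>. (Z \<omega>, K \<omega>, V \<omega>)) + 1 + measure_pmf.prob \<mu> err * (n * log 2 CARD('x))"
proof -
  let ?U = "\<lambda>\<omega>. if \<omega> \<in> err then Some (X \<omega>) else None"
  have "ent \<mu> (\<lambda>\<omega>. (S \<omega>, K \<omega>, V \<omega>)) \<le> ent \<mu> (\<lambda>\<omega>. ((Z \<omega>, K \<omega>, V \<omega>), ?U \<omega>))"
    by (rule ent_function_le[OF fin_\<mu>, where \<phi> = "\<lambda>((zz, k, v), u).
        (case u of None \<Rightarrow> gd k (\<lambda>t. fst (v t)) zz | Some x \<Rightarrow> (\<lambda>t. if t < n then e t k x else 0), k, v)"])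
      (auto simp: err_def)
  also have "\<dots> \<le> ent \<mu> (\<lambda>\<omega>. (Z \<omega>, K \<omega>, V \<omega>)) + ent \<mu> ?U"
    by (rule ent_Pair_le[OF fin_\<mu>])
  finally show ?thesis using ent_Fano_le by simp
qed

lemma ent_SKV_ge:
  fixes c :: "real \<Rightarrow> real" and D :: real
  assumes c: "\<And>D'. ereal (c D') \<le> rc_SI Px Py Pw d D'"
    and m: "\<And>D'. c D + m * (D' - D) \<le> c D'"
  shows "ent \<mu> (\<lambda>\<omega>. (K \<omega>, V \<omega>)) + n * c D
      + m * ((\<Sum>t<n. measure_pmf.expectation \<mu> (\<lambda>\<omega>. d (X \<omega> t) (Xh \<omega> t))) - n * D)
    \<le> ent \<mu> (\<lambda>\<omega>. (S \<omega>, K \<omega>, V \<omega>))"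
proof -
  define Sf where "Sf = (\<lambda>k (\<omega> :: nat \<Rightarrow> 'x \<times> 'y \<times> 'w) t. if t < n then e t k (\<lambda>i. fst (\<omega> i)) else 0)"
  define Yf where "Yf = (\<lambda>(\<omega> :: nat \<Rightarrow> 'x \<times> 'y \<times> 'w) t. fst (snd (\<omega> t)))"
  \<comment> \<open>The side information is part of each letter, so the chain rule bounds the joint
    entropy with \<open>V\<close>; the terms H(V_t) it produces add up to H(K, V^n) - H(K).\<close>
  define \<sigma> where "\<sigma> = (\<lambda>t k \<omega>. (e t k (\<lambda>i. fst (\<omega> i)), snd (\<omega> t)) :: nat \<times> 'y \<times> 'w)"
  define \<delta> where "\<delta> = (\<lambda>t k \<omega>. d (fst (\<omega> t)) (g t k (Sf k \<omega>) (Yf \<omega>)))"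
  have causal_Sf: "Sf k \<omega> i = Sf k \<omega>' i" if "\<forall>j\<le>i. \<omega> j = \<omega>' j" for k \<omega> \<omega>' i
    unfolding Sf_def using that by (auto intro!: causal_e)
  have causal_\<sigma>: "causal \<sigma>"
    unfolding causal_def \<sigma>_def by (auto intro!: causal_e)
  have causal_\<delta>: "causal \<delta>"
    unfolding causal_def \<delta>_def
  proof (intro allI impI)
    fix t k and \<omega> \<omega>' :: "nat \<Rightarrow> 'x \<times> 'y \<times> 'w" assume eq: "\<forall>i\<le>t. \<omega> i = \<omega>' i"
    hence "g t k (Sf k \<omega>) (Yf \<omega>) = g t k (Sf k \<omega>') (Yf \<omega>')"
      by (intro causal_g allI impI conjI causal_Sf) (auto simp: Yf_def)
    thus "d (fst (\<omega> t)) (g t k (Sf k \<omega>) (Yf \<omega>)) = d (fst (\<omega>' t)) (g t k (Sf k \<omega>') (Yf \<omega>'))"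
      using eq by simp
  qed
  have step: "ent P snd + c D + m * (measure_pmf.expectation P (\<lambda>p. \<delta> t k ((\<omega>)(t := p))) - D)
      \<le> ent P (\<lambda>p. \<sigma> t k ((\<omega>)(t := p)))" if t: "t < n" for t k \<omega>
  proof -
    define F where "F = (\<lambda>x. e t k (\<lambda>i. if i = t then x else fst (\<omega> i)))"
    define G where "G = (\<lambda>s y. g t k ((Sf k \<omega>)(t := s)) ((Yf \<omega>)(t := y)))"
    have F: "e t k (\<lambda>i. fst (((\<omega>)(t := p)) i)) = F (fst p)" for p
      unfolding F_def by (rule arg_cong[where f = "e t k"]) auto
    have "\<sigma> t k ((\<omega>)(t := p)) = (F (fst p), snd p)" for p
      unfolding \<sigma>_def F by simp
    moreover have "\<delta> t k ((\<omega>)(t := p)) = d (fst p) (G (F (fst p)) (fst (snd p)))" for p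
    proof -
      have "g t k (Sf k ((\<omega>)(t := p))) (Yf ((\<omega>)(t := p))) = G (F (fst p)) (fst (snd p))"
        unfolding G_def
      proof (intro causal_g allI impI conjI)
        fix i assume "i \<le> t"
        show "Yf ((\<omega>)(t := p)) i = ((Yf \<omega>)(t := fst (snd p))) i" by (simp add: Yf_def)
        show "Sf k ((\<omega>)(t := p)) i = ((Sf k \<omega>)(t := F (fst p))) i"
        proof (cases "i = t")
          case True
          thus ?thesis using t F[of p] by (simp add: Sf_def)
        next
          case False
          thus ?thesis using \<open>i \<le> t\<close> causal_Sf[of i "(\<omega>)(t := p)" \<omega> k] by simp
        qed
      qed
      thus ?thesis by (simp add: \<delta>_def)
    qed
    ultimately show ?thesis using single_letter_bound[OF c m, of G F] by simp
  qed
  note int = integrable_measure_pmf_finite[OF fin_\<mu>]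
  have "ent P snd + c D + m * (measure_pmf.expectation \<mu> (\<lambda>\<omega>. \<delta> t (fst \<omega>) (snd \<omega>)) - D)
      \<le> measure_pmf.expectation \<mu> (\<lambda>\<omega>. ent P (\<lambda>p. \<sigma> t (fst \<omega>) ((snd \<omega>)(t := p))))" if t: "t < n" for t
  proof -
    \<comment> \<open>Averaging the affine single-letter bound over key and past leaves the same
      line, evaluated at the mean distortion of time \<open>t\<close>.\<close>
    have "measure_pmf.expectation \<mu> (\<lambda>\<omega>. ent P snd + c D
          + m * (measure_pmf.expectation P (\<lambda>p. \<delta> t (fst \<omega>) ((snd \<omega>)(t := p))) - D))
        \<le> measure_pmf.expectation \<mu> (\<lambda>\<omega>. ent P (\<lambda>p. \<sigma> t (fst \<omega>) ((snd \<omega>)(t := p))))"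
      by (intro expectation_mono_finite_support fin_\<mu> step t)
    moreover have "measure_pmf.expectation \<mu> (\<lambda>\<omega>. \<delta> t (fst \<omega>) (snd \<omega>))
      = measure_pmf.expectation \<mu> (\<lambda>\<omega>. measure_pmf.expectation P (\<lambda>p. \<delta> t (fst \<omega>) ((snd \<omega>)(t := p))))"
      unfolding \<mu>_def src_n_def by (rule expectation_causal[OF causal_\<delta> t fin_key]) simp
    ultimately show ?thesis by (simp add: int)
  qed
  hence "(\<Sum>t<n. ent P snd + c D + m * (measure_pmf.expectation \<mu> (\<lambda>\<omega>. \<delta> t (fst \<omega>) (snd \<omega>)) - D))
      \<le> (\<Sum>t<n. measure_pmf.expectation \<mu> (\<lambda>\<omega>. ent P (\<lambda>p. \<sigma> t (fst \<omega>) ((snd \<omega>)(t := p)))))"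
    by (intro sum_mono) auto
  also have "ent \<kappa> (\<lambda>k. k) + \<dots> \<le> ent \<mu> (\<lambda>\<omega>. (fst \<omega>, \<lambda>t. if t < n then \<sigma> t (fst \<omega>) (snd \<omega>) else (0, undefined)))"
    unfolding \<mu>_def src_n_def by (rule ent_causal_ge[OF causal_\<sigma> fin_key]) simp
  also have "\<dots> \<le> ent \<mu> (\<lambda>\<omega>. (S \<omega>, K \<omega>, V \<omega>))"
    by (rule ent_function_le[OF fin_\<mu>, where \<phi> = "\<lambda>(s, k, v). (k, \<lambda>t. if t < n then (s t, v t) else (0, undefined))"])
      (auto simp: \<sigma>_def fun_eq_iff)
  finally have "ent \<kappa> (\<lambda>k. k) + (\<Sum>t<n. ent P snd + c D
      + m * (measure_pmf.expectation \<mu> (\<lambda>\<omega>. \<delta> t (fst \<omega>) (snd \<omega>)) - D)) \<le> ent \<mu> (\<lambda>\<omega>. (S \<omega>, K \<omega>, V \<omega>))"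
    by simp
  moreover have "(\<Sum>t<n. ent P snd + c D + m * (measure_pmf.expectation \<mu> (\<lambda>\<omega>. \<delta> t (fst \<omega>) (snd \<omega>)) - D))
      = n * ent P snd + n * c D + m * ((\<Sum>t<n. measure_pmf.expectation \<mu> (\<lambda>\<omega>. \<delta> t (fst \<omega>) (snd \<omega>))) - n * D)"
    by (simp add: sum.distrib sum_distrib_left[symmetric] sum_subtractf, simp add: distrib_left)
  moreover have "ent \<mu> (\<lambda>\<omega>. (K \<omega>, V \<omega>)) = ent \<kappa> (\<lambda>k. k) + n * ent P snd"
    using ent_key_source[where \<phi> = snd] .
  ultimately show ?thesis by (simp add: \<delta>_def Sf_def Yf_def)
qed

abbreviation cond_ent_Z_KV where
  "cond_ent_Z_KV \<equiv> ent \<mu> (\<lambda>\<omega>. (Z \<omega>, K \<omega>, V \<omega>)) - ent \<mu> (\<lambda>\<omega>. (K \<omega>, V \<omega>))"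

lemma cond_ent_Z_KV_le: "cond_ent_Z_KV \<le> ent \<mu> Z"
  using ent_Pair_le[OF fin_\<mu>, of Z "\<lambda>\<omega>. (K \<omega>, V \<omega>)"] by simp

lemma equivocation_le: "cond_ent \<mu> X (\<lambda>\<omega>. (W \<omega>, Z \<omega>)) \<le> n * H_XW"
  using ent_strong_subadditive[OF fin_\<mu>, of X W Z] unfolding H_XW_eq cond_ent_def[of \<mu>] by linarith

text \<open>The key is paid for twice, once in bounding H(X^n, W^n, Z) from above and once in
  bounding H(W^n, Z) from below; its independence of W^n gives one copy back. Passing from W^n to
  \<open>V\<close> in the condition only lowers the entropy of Z.\<close>

lemma equivocation_le_key:
  "cond_ent \<mu> X (\<lambda>\<omega>. (W \<omega>, Z \<omega>)) \<le> n * H_XW + ent \<mu> K - cond_ent_Z_KV"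
proof -
  have "ent \<mu> (\<lambda>\<omega>. (X \<omega>, W \<omega>, Z \<omega>)) \<le> ent \<mu> (\<lambda>\<omega>. ((X \<omega>, W \<omega>), K \<omega>))"
    by (rule ent_function_le[OF fin_\<mu>, where \<phi> = "\<lambda>((x, w), k). (x, w, z k x)"]) simp
  also have "\<dots> \<le> ent \<mu> (\<lambda>\<omega>. (X \<omega>, W \<omega>)) + ent \<mu> K"
    by (rule ent_Pair_le[OF fin_\<mu>])
  finally have 1: "ent \<mu> (\<lambda>\<omega>. (X \<omega>, W \<omega>, Z \<omega>)) \<le> ent \<mu> (\<lambda>\<omega>. (X \<omega>, W \<omega>)) + ent \<mu> K" .
  have "ent \<mu> (\<lambda>\<omega>. (Z \<omega>, K \<omega>, W \<omega>)) \<le> ent \<mu> (\<lambda>\<omega>. ((W \<omega>, Z \<omega>), K \<omega>))"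
    by (rule ent_function_le[OF fin_\<mu>, where \<phi> = "\<lambda>((w, zz), k). (zz, k, w)"]) simp
  also have "\<dots> \<le> ent \<mu> (\<lambda>\<omega>. (W \<omega>, Z \<omega>)) + ent \<mu> K"
    by (rule ent_Pair_le[OF fin_\<mu>])
  finally have 2: "ent \<mu> (\<lambda>\<omega>. (Z \<omega>, K \<omega>, W \<omega>)) \<le> ent \<mu> (\<lambda>\<omega>. (W \<omega>, Z \<omega>)) + ent \<mu> K" .
  have "ent \<mu> (\<lambda>\<omega>. (Z \<omega>, K \<omega>, V \<omega>)) \<le> ent \<mu> (\<lambda>\<omega>. (Z \<omega>, (K \<omega>, W \<omega>), V \<omega>))"
    by (rule ent_function_le[OF fin_\<mu>, where \<phi> = "\<lambda>(zz, (k, w), v). (zz, k, v)"]) simp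
  moreover have "ent \<mu> (\<lambda>\<omega>. ((K \<omega>, W \<omega>), V \<omega>)) \<le> ent \<mu> (\<lambda>\<omega>. (K \<omega>, V \<omega>))"
    by (rule ent_function_le[OF fin_\<mu>, where \<phi> = "\<lambda>(k, v). ((k, \<lambda>t. snd (v t)), v)"]) simp
  ultimately have 3: "ent \<mu> (\<lambda>\<omega>. (Z \<omega>, K \<omega>, V \<omega>)) + ent \<mu> (\<lambda>\<omega>. (K \<omega>, W \<omega>))
      \<le> ent \<mu> (\<lambda>\<omega>. (Z \<omega>, K \<omega>, W \<omega>)) + ent \<mu> (\<lambda>\<omega>. (K \<omega>, V \<omega>))"
    using ent_strong_subadditive[OF fin_\<mu>, of Z "\<lambda>\<omega>. (K \<omega>, W \<omega>)" V] by simp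
  have 4: "ent \<mu> (\<lambda>\<omega>. (K \<omega>, W \<omega>)) = ent \<mu> K + ent \<mu> W"
    using ent_key_source[where \<phi> = "\<lambda>p. snd (snd p)"] ent_source[where \<phi> = "\<lambda>p. snd (snd p)"]
    by (simp add: ent_key)
  show ?thesis using 1 2 3 4 unfolding H_XW_eq cond_ent_def[of \<mu>] by linarith
qed

text \<open>Each loss is a multiple of \<epsilon>: \<open>m\<close> from the distortion slack, where
  the sign of the slope enters, 1 from the single bit in Fano's inequality since
  \<open>1 / n \<le> \<epsilon>\<close>, and log |X| from the error probability.\<close>

lemma converse_bound:
  fixes c :: "real \<Rightarrow> real" and D :: real
  assumes c: "\<And>D'. ereal (c D') \<le> rc_SI Px Py Pw d D'"
    and m: "\<And>D'. c D + m * (D' - D) \<le> c D'" "m \<le> 0"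
    and n: "n > 0" and \<epsilon>: "\<epsilon> \<ge> 0" "1 / n \<le> \<epsilon>"
    and err: "measure_pmf.prob \<mu> err < \<epsilon>"
    and dist: "(\<Sum>t<n. measure_pmf.expectation \<mu> (\<lambda>\<omega>. d (X \<omega> t) (Xh \<omega> t))) / n \<le> D + \<epsilon>"
  shows "c D + \<epsilon> * (m - 1 - log 2 CARD('x)) \<le> cond_ent_Z_KV / n"
proof -
  define \<Delta> where "\<Delta> = (\<Sum>t<n. measure_pmf.expectation \<mu> (\<lambda>\<omega>. d (X \<omega> t) (Xh \<omega> t)))"
  have "\<Delta> - n * D \<le> n * \<epsilon>"
    using dist n unfolding \<Delta>_def[symmetric] by (simp add: field_simps)
  hence "m * (n * \<epsilon>) \<le> m * (\<Delta> - n * D)" using m(2) by (rule mult_left_mono_neg)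
  moreover have "1 \<le> n * \<epsilon>" using \<epsilon>(2) n by (simp add: field_simps)
  moreover have "measure_pmf.prob \<mu> err * (n * log 2 CARD('x)) \<le> \<epsilon> * (n * log 2 CARD('x))"
    using err by (intro mult_right_mono mult_nonneg_nonneg) auto
  ultimately have "n * c D + m * (n * \<epsilon>) - n * \<epsilon> - \<epsilon> * (n * log 2 CARD('x)) \<le> cond_ent_Z_KV"
    using ent_SKV_ge[OF c m(1)] ent_SKV_le unfolding \<Delta>_def by linarith
  also have "n * c D + m * (n * \<epsilon>) - n * \<epsilon> - \<epsilon> * (n * log 2 CARD('x))
      = (c D + \<epsilon> * (m - 1 - log 2 CARD('x))) * n" by (simp add: algebra_simps)
  finally show ?thesis using n by (simp add: pos_le_divide_eq)
qed

end

section \<open>From bounds on single codes to the region\<close>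

text \<open>The condition that the region imposes on one code, in the same wording, so that
  unfolding identifies the two. As a predicate it can be assumed in one direction and constructed in
  the other.\<close>

definition code_within :: "'x::finite pmf \<Rightarrow> ('x \<Rightarrow> 'y::finite pmf) \<Rightarrow> ('y \<Rightarrow> 'w::finite pmf)
    \<Rightarrow> ('x \<Rightarrow> 'xh::finite \<Rightarrow> real) \<Rightarrow> real \<Rightarrow> real \<Rightarrow> real \<Rightarrow> real \<Rightarrow> real \<Rightarrow> nat \<Rightarrow> nat pmf
    \<Rightarrow> (nat \<Rightarrow> nat \<Rightarrow> (nat \<Rightarrow> 'x) \<Rightarrow> nat) \<Rightarrow> (nat \<Rightarrow> nat \<Rightarrow> (nat \<Rightarrow> nat) \<Rightarrow> (nat \<Rightarrow> 'y) \<Rightarrow> 'xh)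
    \<Rightarrow> (nat \<Rightarrow> (nat \<Rightarrow> 'x) \<Rightarrow> bool list)
    \<Rightarrow> (nat \<Rightarrow> (nat \<Rightarrow> 'y) \<Rightarrow> bool list \<Rightarrow> (nat \<Rightarrow> nat)) \<Rightarrow> bool" where
  "code_within Px Py Pw d R Rk D h \<epsilon> n \<kappa> e g z gd \<longleftrightarrow>
        finite (set_pmf \<kappa>) \<and>
        (\<exists>M. \<forall>t k x. e t k x < M) \<and>
        (\<forall>t k x x'. (\<forall>i\<le>t. x i = x' i) \<longrightarrow> e t k x = e t k x') \<and>
        (\<forall>t k s s' y y'. (\<forall>i\<le>t. s i = s' i \<and> y i = y' i) \<longrightarrow> g t k s y = g t k s' y') \<and>
        (let \<mu> = pair_pmf \<kappa> (src_n (src Px Py Pw) n);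
             K = (\<lambda>\<omega>. fst \<omega>);
             X = (\<lambda>\<omega> t. fst (snd \<omega> t));
             Y = (\<lambda>\<omega> t. fst (snd (snd \<omega> t)));
             W = (\<lambda>\<omega> t. snd (snd (snd \<omega> t)));
             S = (\<lambda>\<omega> t. if t < n then e t (K \<omega>) (X \<omega>) else 0);
             Xh = (\<lambda>\<omega> t. g t (K \<omega>) (S \<omega>) (Y \<omega>));
             Z = (\<lambda>\<omega>. z (K \<omega>) (X \<omega>))
         in measure_pmf.prob \<mu> {\<omega>. S \<omega> \<noteq> gd (K \<omega>) (Y \<omega>) (Z \<omega>)} < \<epsilon> \<and>
            ent \<mu> Z / n \<le> R + \<epsilon> \<and>
            ent \<mu> K / n \<le> Rk + \<epsilon> \<and>
            (\<Sum>t<n. measure_pmf.expectation \<mu> (\<lambda>\<omega>. d (X \<omega> t) (Xh \<omega> t))) / n \<le> D + \<epsilon> \<and>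
            cond_ent \<mu> X (\<lambda>\<omega>. (W \<omega>, Z \<omega>)) / n \<ge> h - \<epsilon>)"

lemma in_RSI_iff_code_within:
  "in_RSI Px Py Pw d R Rk D h \<longleftrightarrow> R > 0 \<and> Rk > 0 \<and> D > 0 \<and> h > 0 \<and>
    (\<forall>\<epsilon>>0. \<exists>N. \<forall>n\<ge>N. \<exists>\<kappa> e g z gd. code_within Px Py Pw d R Rk D h \<epsilon> n \<kappa> e g z gd)"
  unfolding in_RSI_def code_within_def ..

lemma le_if_eps_le:
  fixes a b C :: real
  assumes "\<And>\<epsilon>. \<epsilon> > 0 \<Longrightarrow> a \<le> b + \<epsilon> * C"
  shows "a \<le> b"
proof (rule field_le_epsilon)
  fix \<eta> :: real assume "\<eta> > 0"
  define \<epsilon> where "\<epsilon> = \<eta> / (\<bar>C\<bar> + 1)"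
  have "\<epsilon> > 0" using \<open>\<eta> > 0\<close> unfolding \<epsilon>_def by (intro divide_pos_pos) auto
  have "\<epsilon> * C \<le> \<epsilon> * (\<bar>C\<bar> + 1)" using \<open>\<epsilon> > 0\<close> by (intro mult_left_mono) auto
  also have "\<dots> = \<eta>" unfolding \<epsilon>_def by simp
  finally show "a \<le> b + \<eta>" using assms[OF \<open>\<epsilon> > 0\<close>] by simp
qed

text \<open>The slope argument needs finite values, hence a single real minorant; the supremum over
  minorants is left to the final theorem. The slope is chosen before \<epsilon>, so all losses
  vanish linearly in \<epsilon>.\<close>

lemma RSI_converse:
  fixes Px :: "'x::finite pmf" and Py :: "'x \<Rightarrow> 'y::finite pmf" and Pw :: "'y \<Rightarrow> 'w::finite pmf"
    and d :: "'x \<Rightarrow> 'xh::finite \<Rightarrow> real"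
  assumes RSI: "in_RSI Px Py Pw d R Rk D h"
    and cvx: "convex_on UNIV c" and c: "\<And>D'. ereal (c D') \<le> rc_SI Px Py Pw d D'"
  defines "H \<equiv> cond_ent (src Px Py Pw) (\<lambda>(x,y,w). x) (\<lambda>(x,y,w). w)"
  shows "c D \<le> R" "h \<le> H" "h - H + c D \<le> Rk"
proof -
  obtain m where m: "m \<le> 0" "\<And>D'. c D + m * (D' - D) \<le> c D'"
    using subgradient_rc_SI[OF cvx c] by blast
  define L where "L = log 2 CARD('x)"
  have bounds: "c D + \<epsilon> * (m - 1 - L) \<le> R + \<epsilon> \<and> h - \<epsilon> \<le> H \<and>
      h - \<epsilon> \<le> H + (Rk + \<epsilon>) - (c D + \<epsilon> * (m - 1 - L))" if \<epsilon>: "\<epsilon> > 0" for \<epsilon>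
  proof -
    obtain N where N: "\<And>n. n \<ge> N \<Longrightarrow> \<exists>\<kappa> e g z gd. code_within Px Py Pw d R Rk D h \<epsilon> n \<kappa> e g z gd"
      using RSI \<epsilon> unfolding in_RSI_iff_code_within by meson
    \<comment> \<open>At least 1 / \<epsilon>, so that the single bit in Fano's inequality is at
      most \<open>n * \<epsilon>\<close>.\<close>
    define n where "n = max N (max 1 (nat \<lceil>1 / \<epsilon>\<rceil>))"
    have n: "n \<ge> N" "n > 0" "1 / \<epsilon> \<le> n" unfolding n_def by linarith+
    have n\<epsilon>: "1 / n \<le> \<epsilon>" using n \<epsilon> by (simp add: field_simps)
    obtain \<kappa> e g z gd where code: "code_within Px Py Pw d R Rk D h \<epsilon> n \<kappa> e g z gd"
      using N[OF n(1)] by blast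
    interpret causal_code Px Py Pw d n \<kappa> e g z gd
      using code unfolding code_within_def by unfold_locales (elim conjE, simp)+
    have 1: "measure_pmf.prob \<mu> err < \<epsilon>" "ent \<mu> Z / n \<le> R + \<epsilon>" "ent \<mu> K / n \<le> Rk + \<epsilon>"
      "(\<Sum>t<n. measure_pmf.expectation \<mu> (\<lambda>\<omega>. d (X \<omega> t) (Xh \<omega> t))) / n \<le> D + \<epsilon>"
      "cond_ent \<mu> X (\<lambda>\<omega>. (W \<omega>, Z \<omega>)) / n \<ge> h - \<epsilon>"
      using code unfolding code_within_def Let_def \<mu>_def err_def by - (elim conjE, assumption)+
    have 2: "c D + \<epsilon> * (m - 1 - L) \<le> cond_ent_Z_KV / n"
      unfolding L_def using converse_bound[OF c m(2,1) n(2) less_imp_le[OF \<epsilon>] n\<epsilon> 1(1) 1(4)] .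
    have 3: "cond_ent_Z_KV / n \<le> ent \<mu> Z / n"
      using cond_ent_Z_KV_le n by (intro divide_right_mono) auto
    have 4: "cond_ent \<mu> X (\<lambda>\<omega>. (W \<omega>, Z \<omega>)) / n \<le> H"
      using divide_right_mono[OF equivocation_le, of "real n"] n by (simp add: H_def)
    have 5: "cond_ent \<mu> X (\<lambda>\<omega>. (W \<omega>, Z \<omega>)) / n \<le> H + ent \<mu> K / n - cond_ent_Z_KV / n"
      using divide_right_mono[OF equivocation_le_key, of "real n"] n
      by (simp add: H_def add_divide_distrib diff_divide_distrib)
    show ?thesis using 1 2 3 4 5 by linarith
  qed
  show "c D \<le> R"
  proof (rule le_if_eps_le)
    fix \<epsilon> :: real assume "\<epsilon> > 0"
    from bounds[OF this] show "c D \<le> R + \<epsilon> * (1 - (m - 1 - L))" by (simp add: algebra_simps)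
  qed
  show "h \<le> H"
  proof (rule le_if_eps_le)
    fix \<epsilon> :: real assume "\<epsilon> > 0"
    from bounds[OF this] show "h \<le> H + \<epsilon> * 1" by (simp add: algebra_simps)
  qed
  show "h - H + c D \<le> Rk"
  proof (rule le_if_eps_le)
    fix \<epsilon> :: real assume "\<epsilon> > 0"
    from bounds[OF this] show "h - H + c D \<le> Rk + \<epsilon> * (2 - (m - 1 - L))" by (simp add: algebra_simps)
  qed
qed

subsection \<open>Time sharing\<close>

text \<open>The penalised infimum \<open>c\<close> is convex and lies below \<open>r\<close>; a steep penalty slope forces its near-minimisers
  to almost meet the distortion constraint.\<close>
lemma lower_convex_env_mixture:
  fixes A :: "(real \<times> real) set"
  assumes ne: "A \<noteq> {}" and nonneg: "\<And>q. q \<in> A \<Longrightarrow> 0 \<le> snd q"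
    and r: "\<And>D' b. (\<And>q. q \<in> A \<Longrightarrow> fst q \<le> D' \<Longrightarrow> b \<le> snd q) \<Longrightarrow> ereal b \<le> r D'"
    and env: "lower_convex_env r D \<le> ereal v" and \<delta>: "\<delta> > 0"
  obtains q where "q \<in> convex hull A" "snd q \<le> v + \<delta>" "fst q \<le> D + \<delta>"
proof -
  \<comment> \<open>As \<open>snd q\<close> is nonnegative on the hull, a penalised value below
    \<open>v + \<delta>\<close> bounds the penalty by |v| + \<delta>, which equals
    \<open>L * \<delta>\<close>, and hence the excess distortion by \<delta>.\<close>
  define L where "L = (\<bar>v\<bar> + \<delta>) / \<delta>"
  have L: "L > 0" unfolding L_def using \<delta> by (intro divide_pos_pos) auto
  \<comment> \<open>A soft penalty keeps \<open>c\<close> real at every level, also where no coder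
    is feasible. It is jointly convex in level and point, and taking the infimum over the convex
    hull preserves convexity in the level.\<close>
  define \<phi> where "\<phi> = (\<lambda>D' q. snd q + L * max 0 (fst q - D') :: real)"
  define c where "c = (\<lambda>D'. Inf (\<phi> D' ` (convex hull A)))"
  have neH: "convex hull A \<noteq> {}" using ne by simp
  have sndH: "0 \<le> snd q" if "q \<in> convex hull A" for q
  proof -
    have "convex {q :: real \<times> real. 0 \<le> snd q}"
      by (auto simp: convex_def)
    hence "convex hull A \<subseteq> {q. 0 \<le> snd q}" using nonneg by (intro hull_minimal) auto
    thus ?thesis using that by auto
  qed
  have bdd: "bdd_below (\<phi> D' ` (convex hull A))" for D'
    using sndH L by (intro bdd_belowI[of _ 0]) (auto simp: \<phi>_def)
  have c_le: "c D' \<le> \<phi> D' q" if "q \<in> convex hull A" for D' q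
    unfolding c_def using that bdd by (intro cInf_lower) auto
  have c_ex: "\<exists>q\<in>convex hull A. \<phi> D' q < c D' + \<eta>" if "\<eta> > 0" for D' \<eta>
    using cInf_lessD[of "\<phi> D' ` (convex hull A)" "c D' + \<eta>"] that neH unfolding c_def by auto
  have "convex_on UNIV c"
  proof (rule convex_onI)
    fix t x y :: real assume t: "0 < t" "t < 1"
    show "c ((1 - t) *\<^sub>R x + t *\<^sub>R y) \<le> (1 - t) * c x + t * c y"
    proof (rule field_le_epsilon)
      fix \<eta> :: real assume "\<eta> > 0"
      obtain q1 q2 where q: "q1 \<in> convex hull A" "\<phi> x q1 < c x + \<eta>" "q2 \<in> convex hull A" "\<phi> y q2 < c y + \<eta>"
        using c_ex[OF \<open>\<eta> > 0\<close>] by meson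
      let ?q = "(1 - t) *\<^sub>R q1 + t *\<^sub>R q2"
      have "?q \<in> convex hull A"
        using convexD[OF convex_convex_hull q(1,3), of "1 - t" t] t by simp
      hence le: "c ((1 - t) *\<^sub>R x + t *\<^sub>R y) \<le> \<phi> ((1 - t) *\<^sub>R x + t *\<^sub>R y) ?q" by (rule c_le)
      have max_le: "max 0 (fst ?q - ((1 - t) *\<^sub>R x + t *\<^sub>R y))
          \<le> (1 - t) * max 0 (fst q1 - x) + t * max 0 (fst q2 - y)"
      proof -
        have "(1 - t) * (fst q1 - x) \<le> (1 - t) * max 0 (fst q1 - x)" "t * (fst q2 - y) \<le> t * max 0 (fst q2 - y)"
          using t by (auto intro!: mult_left_mono)
        moreover have "0 \<le> (1 - t) * max 0 (fst q1 - x) + t * max 0 (fst q2 - y)"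
          using t by (intro add_nonneg_nonneg mult_nonneg_nonneg) auto
        moreover have "fst ?q - ((1 - t) *\<^sub>R x + t *\<^sub>R y) = (1 - t) * (fst q1 - x) + t * (fst q2 - y)"
          by (simp add: algebra_simps)
        ultimately show ?thesis by (simp only: max.boundedI add_mono)
      qed
      note le
      also have "\<phi> ((1 - t) *\<^sub>R x + t *\<^sub>R y) ?q
          \<le> snd ?q + L * ((1 - t) * max 0 (fst q1 - x) + t * max 0 (fst q2 - y))"
        unfolding \<phi>_def using L max_le by (intro add_left_mono mult_left_mono) auto
      also have "\<dots> = (1 - t) * \<phi> x q1 + t * \<phi> y q2"
      proof -
        define m1 m2 where "m1 = max 0 (fst q1 - x)" and "m2 = max 0 (fst q2 - y)"
        show ?thesis unfolding \<phi>_def m1_def[symmetric] m2_def[symmetric] by (simp add: algebra_simps)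
      qed
      also have "\<dots> \<le> (1 - t) * (c x + \<eta>) + t * (c y + \<eta>)"
        using t q by (intro add_mono mult_left_mono) auto
      also have "\<dots> = (1 - t) * c x + t * c y + \<eta>" by (simp add: algebra_simps)
      finally show "c ((1 - t) *\<^sub>R x + t *\<^sub>R y) \<le> (1 - t) * c x + t * c y + \<eta>" .
    qed
  qed auto
  moreover have "ereal (c D') \<le> r D'" for D'
  proof (rule r)
    fix q assume "q \<in> A" "fst q \<le> D'"
    thus "c D' \<le> snd q" using c_le[of q D'] hull_subset[of A convex] by (auto simp: \<phi>_def)
  qed
  ultimately have "ereal (c D) \<le> lower_convex_env r D"
    unfolding lower_convex_env_def by (intro Sup_upper) auto
  with env have "c D \<le> v" using order_trans by fastforce
  with c_ex[OF \<delta>, of D] obtain q where q: "q \<in> convex hull A" "\<phi> D q < v + \<delta>" by fastforce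
  have "0 \<le> L * max 0 (fst q - D)" using L by simp
  hence 1: "snd q \<le> v + \<delta>" using q(2) unfolding \<phi>_def by linarith
  have "L * max 0 (fst q - D) \<le> L * \<delta>"
    using q(2) sndH[OF q(1)] \<delta> unfolding \<phi>_def L_def by simp
  hence "fst q \<le> D + \<delta>" using L by simp
  with q(1) 1 show ?thesis using that by blast
qed

text \<open>Always stepping to a point of \<open>A\<close> on the far side of \<open>q\<close> from the accumulated deviation keeps the
  deviation of order \<open>sqrt n\<close>.\<close>
lemma convex_hull_sequence:
  fixes A :: "'a::real_inner set"
  assumes q: "q \<in> convex hull A" and B: "\<And>p. p \<in> A \<Longrightarrow> norm (p - q) \<le> B"
  obtains s where "\<And>t. s t \<in> A" "\<And>n. (norm (\<Sum>t<n. s t - q))\<^sup>2 \<le> real n * B\<^sup>2"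
proof -
  \<comment> \<open>Otherwise \<open>A\<close>, and with it the hull, lies in an open half-space
    that excludes \<open>q\<close>.\<close>
  have ex: "\<exists>p\<in>A. inner v (p - q) \<le> 0" for v
  proof (rule ccontr)
    assume "\<not> ?thesis"
    hence "A \<subseteq> {p. inner v p > inner v q}" by (auto simp: inner_diff_right not_le)
    hence "convex hull A \<subseteq> {p. inner v p > inner v q}"
      by (intro hull_minimal convex_halfspace_gt)
    with q show False by auto
  qed
  then obtain nxt where nxt: "\<And>v. nxt v \<in> A" "\<And>v. inner v (nxt v - q) \<le> 0" by metis
  define V where "V = rec_nat 0 (\<lambda>_ v. v + (nxt v - q))"
  have V: "V 0 = 0" "V (Suc n) = V n + (nxt (V n) - q)" for n by (simp_all add: V_def)
  have sum: "(\<Sum>t<n. nxt (V t) - q) = V n" for n by (induction n) (simp_all add: V)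
  have "(norm (V n))\<^sup>2 \<le> real n * B\<^sup>2" for n
  proof (induction n)
    case (Suc n)
    \<comment> \<open>The cross term is nonpositive by the choice of \<open>nxt\<close>, so the
      squared norm grows by at most \<open>B\<^sup>2\<close> per step.\<close>
    have "(norm (V (Suc n)))\<^sup>2 = (norm (V n))\<^sup>2 + 2 * inner (V n) (nxt (V n) - q) + (norm (nxt (V n) - q))\<^sup>2"
      unfolding V by (simp add: power2_norm_eq_inner inner_add_left inner_add_right inner_commute)
    also have "\<dots> \<le> real n * B\<^sup>2 + 0 + B\<^sup>2"
      using Suc nxt[of "V n"] B by (intro add_mono power_mono) auto
    finally show ?case by (simp add: algebra_simps)
  qed (simp add: V)
  thus ?thesis using nxt by (intro that[of "\<lambda>t. nxt (V t)"]) (auto simp: sum)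
qed

lemma abs_fst_le_norm: "\<bar>fst v\<bar> \<le> norm (v :: real \<times> real)"
  using norm_fst_le[of "fst v" "snd v"] by simp

lemma abs_snd_le_norm: "\<bar>snd v\<bar> \<le> norm (v :: real \<times> real)"
  using norm_snd_le[of "snd v" "fst v"] by simp

text \<open>A deviation of at most B sqrt n is within n \<delta> once n \<ge> B^2 / \<delta>^2. The
  same sequence serves every block length and every \<delta>.\<close>

lemma time_sharing_sequence:
  fixes A :: "(real \<times> real) set"
  assumes q: "q \<in> convex hull A" and A: "bounded A"
  obtains s where "\<And>t. s t \<in> A"
    "\<And>\<delta>. \<delta> > 0 \<Longrightarrow> \<exists>N. \<forall>n\<ge>N. (\<Sum>t<n. fst (s t)) \<le> real n * (fst q + \<delta>) \<and> (\<Sum>t<n. snd (s t)) \<le> real n * (snd q + \<delta>)"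
proof -
  obtain B0 where B0: "\<And>p. p \<in> A \<Longrightarrow> norm p \<le> B0" using A by (auto simp: bounded_iff)
  define B where "B = B0 + norm q"
  have B: "norm (p - q) \<le> B" if "p \<in> A" for p
    using B0[OF that] norm_triangle_ineq4[of p q] unfolding B_def by linarith
  obtain s where s: "\<And>t. s t \<in> A" "\<And>n. (norm (\<Sum>t<n. s t - q))\<^sup>2 \<le> real n * B\<^sup>2"
    by (rule convex_hull_sequence[OF q B], assumption, rule that)
  have avg: "\<exists>N. \<forall>n\<ge>N. (\<Sum>t<n. fst (s t)) \<le> real n * (fst q + \<delta>) \<and> (\<Sum>t<n. snd (s t)) \<le> real n * (snd q + \<delta>)"
    if \<delta>: "\<delta> > 0" for \<delta>
  proof (intro exI[of _ "nat \<lceil>B\<^sup>2 / \<delta>\<^sup>2\<rceil>"] allI impI)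
    fix n assume n: "n \<ge> nat \<lceil>B\<^sup>2 / \<delta>\<^sup>2\<rceil>"
    have "B\<^sup>2 / \<delta>\<^sup>2 \<le> n" using n by linarith
    hence "B\<^sup>2 \<le> real n * \<delta>\<^sup>2" using \<delta> by (simp add: field_simps)
    hence "n * B\<^sup>2 \<le> n * (real n * \<delta>\<^sup>2)" by (intro mult_left_mono) auto
    hence "(norm (\<Sum>t<n. s t - q))\<^sup>2 \<le> (real n * \<delta>)\<^sup>2"
      using s(2)[of n] by (simp add: power2_eq_square mult_ac)
    hence le: "norm (\<Sum>t<n. s t - q) \<le> real n * \<delta>" using \<delta> by (simp add: power2_le_iff_abs_le)
    have "(\<Sum>t<n. fst (s t)) - n * fst q = fst (\<Sum>t<n. s t - q)"
      "(\<Sum>t<n. snd (s t)) - n * snd q = snd (\<Sum>t<n. s t - q)"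
      by (simp_all add: fst_sum snd_sum sum_subtractf)
    moreover have "\<bar>fst (\<Sum>t<n. s t - q)\<bar> \<le> norm (\<Sum>t<n. s t - q)" "\<bar>snd (\<Sum>t<n. s t - q)\<bar> \<le> norm (\<Sum>t<n. s t - q)"
      by (rule abs_fst_le_norm abs_snd_le_norm)+
    ultimately have "(\<Sum>t<n. fst (s t)) \<le> n * fst q + real n * \<delta>" "(\<Sum>t<n. snd (s t)) \<le> n * snd q + real n * \<delta>"
      using le by (simp_all add: abs_le_iff)
    thus "(\<Sum>t<n. fst (s t)) \<le> real n * (fst q + \<delta>) \<and> (\<Sum>t<n. snd (s t)) \<le> real n * (snd q + \<delta>)"
      by (simp add: distrib_left)
  qed
  show ?thesis by (rule that[OF s(1) avg])
qed

subsection \<open>Slepian-Wolf coding\<close>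

text \<open>A derandomised form of random binning: colour the points one at a time, each with the least
  conflicting colour.\<close>
lemma ex_low_conflict_colouring:
  fixes w :: "'s \<Rightarrow> 's \<Rightarrow> real"
  assumes A: "finite A" and C: "finite C" "C \<noteq> {}" and w: "\<And>s. w s s = 0"
  shows "\<exists>b. range b \<subseteq> C \<and>
    card C * (\<Sum>s\<in>A. \<Sum>s'\<in>A. if b s = b s' then w s s' else 0) \<le> (\<Sum>s\<in>A. \<Sum>s'\<in>A. w s s')"
  using A
proof (induction A)
  case empty
  obtain c where "c \<in> C" using C by blast
  thus ?case by (intro exI[of _ "\<lambda>_. c"]) auto
next
  case (insert a A)
  then obtain b where b: "range b \<subseteq> C"
    "card C * (\<Sum>s\<in>A. \<Sum>s'\<in>A. if b s = b s' then w s s' else 0) \<le> (\<Sum>s\<in>A. \<Sum>s'\<in>A. w s s')" by blast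
  define T where "T = (\<Sum>s\<in>A. \<Sum>s'\<in>A. if b s = b s' then w s s' else 0)"
  \<comment> \<open>Extra conflict when \<open>a\<close> receives colour \<open>j\<close>. Each
    earlier point is charged to exactly one colour, so some colour costs at most the
    average.\<close>
  define E where "E = (\<lambda>j. \<Sum>s\<in>A. if b s = j then w a s + w s a else 0)"
  have "(\<Sum>j\<in>C. E j) = (\<Sum>s\<in>A. \<Sum>j\<in>C. if b s = j then w a s + w s a else 0)"
    unfolding E_def by (rule sum.swap)
  also have "\<dots> = (\<Sum>s\<in>A. w a s + w s a)"
    using b(1) C by (intro sum.cong refl) (auto simp: sum.delta')
  finally have sumE: "(\<Sum>j\<in>C. E j) = (\<Sum>s\<in>A. w a s + w s a)" .
  obtain j where j: "j \<in> C" "card C * E j \<le> (\<Sum>j\<in>C. E j)"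
  proof -
    have "\<exists>j\<in>C. card C * E j \<le> (\<Sum>j\<in>C. E j)"
    proof (rule ccontr)
      assume "\<not> ?thesis"
      hence "(\<Sum>i\<in>C. \<Sum>j\<in>C. E j) < (\<Sum>i\<in>C. card C * E i)"
        using C by (intro sum_strict_mono) (auto simp: not_le)
      thus False by (simp add: sum_distrib_left)
    qed
    thus ?thesis using that by blast
  qed
  have neq: "s \<noteq> a" if "s \<in> A" for s using that insert by auto
  have "(\<Sum>s\<in>insert a A. \<Sum>s'\<in>insert a A. if (b(a := j)) s = (b(a := j)) s' then w s s' else 0) = T + E j"
  proof -
    have "(\<Sum>s\<in>A. \<Sum>s'\<in>A. if (b(a := j)) s = (b(a := j)) s' then w s s' else 0) = T"
      unfolding T_def by (intro sum.cong refl) (auto dest: neq)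
    moreover have "(\<Sum>s'\<in>A. if (b(a := j)) a = (b(a := j)) s' then w a s' else 0)
        = (\<Sum>s\<in>A. if b s = j then w a s else 0)"
      by (intro sum.cong refl) (auto dest: neq)
    moreover have "(\<Sum>s\<in>A. if (b(a := j)) s = (b(a := j)) a then w s a else 0)
        = (\<Sum>s\<in>A. if b s = j then w s a else 0)"
      by (intro sum.cong refl) (auto dest: neq)
    moreover have "E j = (\<Sum>s\<in>A. if b s = j then w a s else 0) + (\<Sum>s\<in>A. if b s = j then w s a else 0)"
      unfolding E_def sum.distrib[symmetric] by (intro sum.cong refl) auto
    ultimately show ?thesis using insert.hyps w
      unfolding sum.insert[OF insert.hyps] sum.distrib by simp
  qed
  moreover have "(\<Sum>s\<in>insert a A. \<Sum>s'\<in>insert a A. w s s') = (\<Sum>s\<in>A. \<Sum>s'\<in>A. w s s') + (\<Sum>s\<in>A. w a s + w s a)"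
    using insert.hyps w by (simp add: sum.distrib)
  moreover have "card C * (T + E j) \<le> (\<Sum>s\<in>A. \<Sum>s'\<in>A. w s s') + (\<Sum>s\<in>A. w a s + w s a)"
    using b(2) j(2) sumE unfolding T_def[symmetric] by (simp add: distrib_left)
  moreover have "range (b(a := j)) \<subseteq> C" using b(1) j(1) by auto
  ultimately show ?case by (intro exI[of _ "b(a := j)"]) simp
qed

text \<open>The decoder searches the bin for a value whose conditional probability given
  \<open>y\<close> is at least \<tau>. At most 1 / \<tau> values qualify for each \<open>y\<close>,
  so under a good colouring a rival shares the bin with probability at most
  \<open>1 / (\<tau> * card C)\<close>; the other error event is that the true value does not
  qualify.\<close>

lemma one_shot_Slepian_Wolf:
  fixes M :: "('s \<times> 'y) pmf"
  assumes fin: "finite (set_pmf M)" and C: "finite C" "C \<noteq> {}" and \<tau>: "\<tau> > 0"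
  obtains b dec where "range b \<subseteq> C"
    "measure_pmf.prob M {(s, y). dec y (b s) \<noteq> s}
      \<le> measure_pmf.prob M {(s, y). pmf M (s, y) < \<tau> * pmf (map_pmf snd M) y} + 1 / (\<tau> * card C)"
proof -
  define A where "A = fst ` set_pmf M"
  define YS where "YS = snd ` set_pmf M"
  define T where "T = (\<lambda>y. {s\<in>A. \<tau> * pmf (map_pmf snd M) y \<le> pmf M (s, y)})"
  \<comment> \<open>The probability that \<open>s\<close> occurs while \<open>s'\<close> qualifies
    as a rival; its sum over pairs in a common bin bounds the ambiguity.\<close>
  define w where "w = (\<lambda>s s'. if s = s' then 0 else \<Sum>y\<in>YS. if s' \<in> T y then pmf M (s, y) else 0)"
  have finA: "finite A" "finite YS" using fin by (auto simp: A_def YS_def)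
  have sub: "set_pmf M \<subseteq> A \<times> YS" unfolding A_def YS_def by force
  have finT: "finite (T y)" for y using finA by (auto simp: T_def)
  obtain b where b: "range b \<subseteq> C"
    "card C * (\<Sum>s\<in>A. \<Sum>s'\<in>A. if b s = b s' then w s s' else 0) \<le> (\<Sum>s\<in>A. \<Sum>s'\<in>A. w s s')"
    using ex_low_conflict_colouring[OF finA(1) C, of w] by (auto simp: w_def)
  \<comment> \<open>Correct as soon as the true value qualifies and no rival in its bin
    does.\<close>
  define dec where "dec = (\<lambda>y c. SOME s. s \<in> T y \<and> b s = c)"
  have marg: "(\<Sum>s\<in>A. pmf M (s, y)) = pmf (map_pmf snd M) y" for y
    using sum_pmf_snd_marginal[OF fin, of A fst snd y] finA by (simp add: A_def)
  have cardT: "card (T y) \<le> 1 / \<tau>" if "y \<in> YS" for y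
  proof -
    have pos: "pmf (map_pmf snd M) y > 0" using that by (intro pmf_positive) (auto simp: YS_def)
    have "card (T y) * (\<tau> * pmf (map_pmf snd M) y) = (\<Sum>s\<in>T y. \<tau> * pmf (map_pmf snd M) y)" by simp
    also have "\<dots> \<le> (\<Sum>s\<in>T y. pmf M (s, y))" by (intro sum_mono) (auto simp: T_def)
    also have "\<dots> \<le> (\<Sum>s\<in>A. pmf M (s, y))" using finA by (intro sum_mono2) (auto simp: T_def)
    finally have "(card (T y) * \<tau>) * pmf (map_pmf snd M) y \<le> 1 * pmf (map_pmf snd M) y"
      unfolding marg by (simp add: mult_ac)
    hence "card (T y) * \<tau> \<le> 1" using pos by (simp only: mult_le_cancel_right_pos)
    thus ?thesis using \<tau> by (simp add: field_simps)
  qed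
  have "(\<Sum>s\<in>A. \<Sum>s'\<in>A. w s s') \<le> (\<Sum>s\<in>A. \<Sum>s'\<in>A. \<Sum>y\<in>YS. if s' \<in> T y then pmf M (s, y) else 0)"
    by (intro sum_mono) (auto simp: w_def intro!: sum_nonneg)
  also have "\<dots> = (\<Sum>s\<in>A. \<Sum>y\<in>YS. \<Sum>s'\<in>A. if s' \<in> T y then pmf M (s, y) else 0)"
    by (intro sum.cong refl sum.swap)
  also have "\<dots> = (\<Sum>s\<in>A. \<Sum>y\<in>YS. card (T y) * pmf M (s, y))"
  proof (intro sum.cong refl)
    fix s y
    have "A \<inter> {s'. s' \<in> T y} = T y" by (auto simp: T_def)
    thus "(\<Sum>s'\<in>A. if s' \<in> T y then pmf M (s, y) else 0) = card (T y) * pmf M (s, y)"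
      using finA by (simp add: sum.If_cases)
  qed
  also have "\<dots> \<le> (\<Sum>s\<in>A. \<Sum>y\<in>YS. 1 / \<tau> * pmf M (s, y))"
    by (intro sum_mono mult_right_mono cardT) auto
  also have "\<dots> = 1 / \<tau> * (\<Sum>p\<in>A \<times> YS. pmf M p)"
    by (simp add: sum_distrib_left sum.cartesian_product case_prod_unfold)
  also have "(\<Sum>p\<in>A \<times> YS. pmf M p) = 1"
    using finA sub by (intro sum_pmf_eq_1) auto
  finally have wsum: "(\<Sum>s\<in>A. \<Sum>s'\<in>A. w s s') \<le> 1 / \<tau>" by simp
  define Bad where "Bad = {(s, y). \<exists>s'\<in>T y. s' \<noteq> s \<and> b s = b s'}"
  have "measure_pmf.prob M Bad = measure_pmf.prob M ((A \<times> YS) \<inter> Bad)"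
    using sub by (intro measure_pmf.finite_measure_eq_AE) (auto simp: AE_measure_pmf_iff)
  also have "\<dots> = (\<Sum>p\<in>(A \<times> YS) \<inter> Bad. pmf M p)"
    using finA by (intro measure_measure_pmf_finite) auto
  also have "\<dots> = (\<Sum>p\<in>A \<times> YS. if p \<in> Bad then pmf M p else 0)"
    using finA by (intro sum.inter_restrict) simp
  also have "\<dots> = (\<Sum>s\<in>A. \<Sum>y\<in>YS. if (s, y) \<in> Bad then pmf M (s, y) else 0)"
    unfolding sum.cartesian_product by (intro sum.cong refl) auto
  also have "\<dots> \<le> (\<Sum>s\<in>A. \<Sum>y\<in>YS. \<Sum>s'\<in>A. if s \<noteq> s' \<and> b s = b s' \<and> s' \<in> T y then pmf M (s, y) else 0)"
  proof (intro sum_mono)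
    fix s y
    show "(if (s, y) \<in> Bad then pmf M (s, y) else 0)
        \<le> (\<Sum>s'\<in>A. if s \<noteq> s' \<and> b s = b s' \<and> s' \<in> T y then pmf M (s, y) else 0)"
    proof (cases "(s, y) \<in> Bad")
      case True
      then obtain s' where s': "s' \<in> T y" "s' \<noteq> s" "b s = b s'" by (auto simp: Bad_def)
      have "s' \<in> A" using s' by (auto simp: T_def)
      hence "(if s \<noteq> s' \<and> b s = b s' \<and> s' \<in> T y then pmf M (s, y) else 0)
          \<le> (\<Sum>s'\<in>A. if s \<noteq> s' \<and> b s = b s' \<and> s' \<in> T y then pmf M (s, y) else 0)"
        using finA by (intro member_le_sum) auto
      thus ?thesis using True s' by simp
    qed (auto intro: sum_nonneg)
  qed
  also have "\<dots> = (\<Sum>s\<in>A. \<Sum>s'\<in>A. \<Sum>y\<in>YS. if s \<noteq> s' \<and> b s = b s' \<and> s' \<in> T y then pmf M (s, y) else 0)"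
    by (intro sum.cong refl sum.swap)
  also have "\<dots> = (\<Sum>s\<in>A. \<Sum>s'\<in>A. if b s = b s' then w s s' else 0)"
  proof (intro sum.cong refl)
    fix s s'
    show "(\<Sum>y\<in>YS. if s \<noteq> s' \<and> b s = b s' \<and> s' \<in> T y then pmf M (s, y) else 0)
        = (if b s = b s' then w s s' else 0)"
      by (cases "s = s'"; cases "b s = b s'") (simp_all add: w_def)
  qed
  also have "\<dots> \<le> 1 / (\<tau> * card C)"
  proof -
    have "card C > 0" using C by (simp add: card_gt_0_iff)
    moreover have "card C * (\<Sum>s\<in>A. \<Sum>s'\<in>A. if b s = b s' then w s s' else 0) \<le> 1 / \<tau>"
      using b(2) wsum by linarith
    ultimately show ?thesis using \<tau> by (simp add: field_simps)
  qed
  finally have bad: "measure_pmf.prob M Bad \<le> 1 / (\<tau> * card C)" .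
  let ?At = "{(s, y). pmf M (s, y) < \<tau> * pmf (map_pmf snd M) y}"
  have "measure_pmf.prob M {(s, y). dec y (b s) \<noteq> s} \<le> measure_pmf.prob M (?At \<union> Bad)"
  proof (rule measure_pmf.finite_measure_mono_AE)
    have "(s, y) \<in> ?At \<union> Bad" if sy: "(s, y) \<in> set_pmf M" "dec y (b s) \<noteq> s" for s y
    proof (cases "(s, y) \<in> ?At")
      case False
      hence "s \<in> T y" using sy sub by (auto simp: T_def)
      hence "dec y (b s) \<in> T y \<and> b (dec y (b s)) = b s"
        unfolding dec_def by (intro someI[of "\<lambda>s'. s' \<in> T y \<and> b s' = b s" s]) simp
      hence "(s, y) \<in> Bad" using sy(2) unfolding Bad_def by (auto intro!: bexI[of _ "dec y (b s)"])
      thus ?thesis by simp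
    qed simp
    thus "AE p in M. p \<in> {(s, y). dec y (b s) \<noteq> s} \<longrightarrow> p \<in> ?At \<union> Bad"
      by (auto simp: AE_measure_pmf_iff)
  qed simp
  also have "\<dots> \<le> measure_pmf.prob M ?At + measure_pmf.prob M Bad"
    by (rule measure_Un_le) auto
  finally show ?thesis using b(1) bad by (intro that[of b dec]) auto
qed

section \<open>Concentration and binning for i.i.d. letters\<close>

text \<open>Hoeffding's inequality. The functions \<open>a t\<close> vary with time because time
  sharing changes the coder from letter to letter.\<close>

lemma Pi_pmf_sum_upper_tail:
  fixes a :: "nat \<Rightarrow> 'a \<Rightarrow> real"
  assumes a: "\<And>t x. x \<in> set_pmf P \<Longrightarrow> 0 \<le> a t x \<and> a t x \<le> B" and B: "B > 0" and n: "n > 0" and \<delta>: "\<delta> \<ge> 0"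
  shows "measure_pmf.prob (Pi_pmf {..<n} dflt (\<lambda>_. P))
      {\<omega>. (\<Sum>t<n. measure_pmf.expectation P (a t)) + real n * \<delta> \<le> (\<Sum>t<n. a t (\<omega> t))}
    \<le> exp (- 2 * real n * \<delta>\<^sup>2 / B\<^sup>2)"
proof -
  let ?M = "Pi_pmf {..<n} dflt (\<lambda>_. P)"
  have E: "measure_pmf.expectation ?M (\<lambda>\<omega>. a t (\<omega> t)) = measure_pmf.expectation P (a t)" if "t < n" for t
  proof -
    have "measure_pmf.expectation ?M (\<lambda>\<omega>. a t (\<omega> t)) = measure_pmf.expectation (map_pmf (\<lambda>\<omega>. \<omega> t) ?M) (a t)"
      by simp
    also have "map_pmf (\<lambda>\<omega>. \<omega> t) ?M = P" using that by (simp add: Pi_pmf_component)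
    finally show ?thesis .
  qed
  interpret H: Hoeffding_ineq ?M "{..<n}" "\<lambda>t \<omega>. a t (\<omega> t)" "\<lambda>_. 0" "\<lambda>_. B"
    "\<Sum>t<n. measure_pmf.expectation P (a t)"
  proof unfold_locales
    show "prob_space.indep_vars (measure_pmf ?M) (\<lambda>_. borel) (\<lambda>t \<omega>. a t (\<omega> t)) {..<n}"
      by (intro prob_space.indep_vars_compose2[OF _ indep_vars_Pi_pmf])
        (auto simp: measure_pmf.prob_space_axioms)
    show "AE \<omega> in ?M. a t (\<omega> t) \<in> {0..B}" if "t \<in> {..<n}" for t
      using that a by (auto simp: AE_measure_pmf_iff set_Pi_pmf PiE_dflt_def)
    show "(\<Sum>t<n. measure_pmf.expectation P (a t)) \<equiv> (\<Sum>t<n. measure_pmf.expectation ?M (\<lambda>\<omega>. a t (\<omega> t)))"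
      by (intro eq_reflection sum.cong refl) (simp add: E)
  qed auto
  have "measure_pmf.prob ?M {\<omega> \<in> space (measure_pmf ?M). (\<Sum>t<n. a t (\<omega> t)) \<ge> (\<Sum>t<n. measure_pmf.expectation P (a t)) + real n * \<delta>}
      \<le> exp (- 2 * (real n * \<delta>)\<^sup>2 / (\<Sum>t<n. (B - 0)\<^sup>2))"
    by (rule H.Hoeffding_ineq_ge) (use n B \<delta> in auto)
  also have "- 2 * (real n * \<delta>)\<^sup>2 / (\<Sum>t<n. (B - 0)\<^sup>2) = - 2 * real n * \<delta>\<^sup>2 / B\<^sup>2"
    using n B by (simp add: power2_eq_square field_simps)
  finally show ?thesis by simp
qed

lemma map_Pi_pmf_coordinatewise:
  fixes n :: nat
  shows "map_pmf (\<lambda>\<omega> t. if t < n then \<phi> t (\<omega> t) else c) (Pi_pmf {..<n} dflt p)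
    = Pi_pmf {..<n} c (\<lambda>t. map_pmf (\<phi> t) (p t))"
proof -
  have "Pi_pmf {..<n} c (\<lambda>t. bind_pmf (p t) (\<lambda>x. return_pmf (\<phi> t x)))
      = bind_pmf (Pi_pmf {..<n} dflt p) (\<lambda>\<omega>. Pi_pmf {..<n} c (\<lambda>t. return_pmf (\<phi> t (\<omega> t))))"
    by (rule Pi_pmf_bind) simp
  thus ?thesis by (simp add: map_pmf_def)
qed

lemma pmf_map_Pi_pmf_coordinatewise:
  fixes n :: nat
  shows "pmf (map_pmf (\<lambda>\<omega> t. if t < n then \<phi> t (\<omega> t) else c) (Pi_pmf {..<n} dflt p))
      (\<lambda>t. if t < n then \<phi> t (\<omega> t) else c)
    = (\<Prod>t<n. pmf (map_pmf (\<phi> t) (p t)) (\<phi> t (\<omega> t)))"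
  unfolding map_Pi_pmf_coordinatewise by (subst pmf_Pi') auto

lemma cond_ent_eq_expectation:
  assumes fin: "finite (set_pmf P)"
  shows "cond_ent P f g = measure_pmf.expectation P
    (\<lambda>x. - log 2 (pmf (map_pmf (\<lambda>x. (f x, g x)) P) (f x, g x) / pmf (map_pmf g P) (g x)))"
proof -
  note int = integrable_measure_pmf_finite[OF fin]
  have "cond_ent P f g = measure_pmf.expectation P (\<lambda>x. - log 2 (pmf (map_pmf (\<lambda>x. (f x, g x)) P) (f x, g x))
      - - log 2 (pmf (map_pmf g P) (g x)))"
    unfolding cond_ent_def ent_eq_expectation[OF fin]
    by (subst Bochner_Integration.integral_diff) (auto intro: int)
  also have "\<dots> = measure_pmf.expectation P
    (\<lambda>x. - log 2 (pmf (map_pmf (\<lambda>x. (f x, g x)) P) (f x, g x) / pmf (map_pmf g P) (g x)))"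
  proof (rule expectation_cong_support)
    fix x assume x: "x \<in> set_pmf P"
    have "pmf (map_pmf (\<lambda>x. (f x, g x)) P) (f x, g x) > 0" "pmf (map_pmf g P) (g x) > 0"
      using x by (auto intro!: pmf_positive)
    thus "- log 2 (pmf (map_pmf (\<lambda>x. (f x, g x)) P) (f x, g x)) - - log 2 (pmf (map_pmf g P) (g x))
      = - log 2 (pmf (map_pmf (\<lambda>x. (f x, g x)) P) (f x, g x) / pmf (map_pmf g P) (g x))"
      by (simp add: log_divide)
  qed
  finally show ?thesis .
qed

text \<open>The joint mass is at least the smallest atom of \<open>P\<close>, and dividing by a
  marginal never decreases it. The resulting range holds for all \<open>f\<close> at once, which is
  what a coder that changes with time requires.\<close>

lemma cond_self_information_bounded:
  assumes fin: "finite (set_pmf P)"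
  obtains B where "B > 0"
    "\<And>f x. x \<in> set_pmf P \<Longrightarrow>
      0 \<le> - log 2 (pmf (map_pmf (\<lambda>x. (f x :: 'b, g x)) P) (f x, g x) / pmf (map_pmf g P) (g x)) \<and>
      - log 2 (pmf (map_pmf (\<lambda>x. (f x, g x)) P) (f x, g x) / pmf (map_pmf g P) (g x)) \<le> B"
proof -
  define pmin where "pmin = Min (pmf P ` set_pmf P)"
  have ne: "pmf P ` set_pmf P \<noteq> {}" by (simp add: set_pmf_not_empty)
  have pmin: "pmin > 0" "\<And>x. x \<in> set_pmf P \<Longrightarrow> pmin \<le> pmf P x"
    unfolding pmin_def using fin ne by (auto simp: pmf_positive)
  obtain x0 where "x0 \<in> set_pmf P" using set_pmf_not_empty[of P] by blast
  hence "pmin \<le> 1" using pmin(2)[of x0] pmf_le_1[of P x0] by linarith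
  hence log: "log 2 pmin \<le> 0" using pmin(1) by simp
  show ?thesis
  \<comment> \<open>The summand 1 keeps the bound positive when \<open>P\<close> is a point
    mass.\<close>
  proof (rule that[of "1 - log 2 pmin"])
    show "1 - log 2 pmin > 0" using log by linarith
  next
    fix f :: "'a \<Rightarrow> 'b" and x assume x: "x \<in> set_pmf P"
    let ?J = "pmf (map_pmf (\<lambda>x. (f x, g x)) P) (f x, g x)" and ?m = "pmf (map_pmf g P) (g x)"
    have "measure_pmf.prob P {x} \<le> measure_pmf.prob P ((\<lambda>x. (f x, g x)) -` {(f x, g x)})"
      by (intro measure_pmf.finite_measure_mono) auto
    hence "pmf P x \<le> ?J" by (simp add: pmf_map measure_pmf_single)
    hence J: "pmin \<le> ?J" using pmin(2)[OF x] by linarith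
    have Jm: "?J \<le> ?m" unfolding pmf_map by (intro measure_pmf.finite_measure_mono) auto
    have m: "?m > 0" "?m \<le> 1" using J Jm pmin(1) pmf_le_1 by (auto intro: order_less_le_trans)
    have J0: "?J > 0" using J pmin(1) by linarith
    have "?J / ?m \<le> 1" using Jm m by (simp add: divide_le_eq_1)
    hence "log 2 (?J / ?m) \<le> 0" using J0 m by simp
    moreover have "pmin \<le> ?J / ?m"
    proof -
      have "pmin * ?m \<le> pmin * 1" using pmin(1) m by (intro mult_left_mono) auto
      also have "\<dots> \<le> ?J" using J by simp
      finally show ?thesis using m by (simp add: pos_le_divide_eq)
    qed
    hence "log 2 pmin \<le> log 2 (?J / ?m)" using pmin(1) J0 m by simp
    ultimately show "0 \<le> - log 2 (?J / ?m) \<and> - log 2 (?J / ?m) \<le> 1 - log 2 pmin" by simp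
  qed
qed

lemma bool_lists_length:
  "finite {l :: bool list. length l = m}" "card {l :: bool list. length l = m} = 2 ^ m"
  "{l :: bool list. length l = m} \<noteq> {}"
proof -
  show fin: "finite {l :: bool list. length l = m}" and card: "card {l :: bool list. length l = m} = 2 ^ m"
    using finite_lists_length_eq[of "UNIV :: bool set" m] card_lists_length_eq[of "UNIV :: bool set" m]
    by auto
  show "{l :: bool list. length l = m} \<noteq> {}" using Ex_list_of_length by blast
qed

text \<open>The two slacks of \<open>n * \<delta>\<close> have different roles: one lifts the
  threshold above the mean self-information and yields the exponential tail, the other makes the
  bins outnumber the qualifying values and yields the power of 2.\<close>

lemma Slepian_Wolf_iid:
  fixes P :: "'a pmf" and g :: "'a \<Rightarrow> 'y" and dflt :: 'a and s0 :: 's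
  assumes fin: "finite (set_pmf P)"
  obtains B where "B > 0"
    "\<And>(f :: nat \<Rightarrow> 'a \<Rightarrow> 's) n \<delta> L. n > 0 \<Longrightarrow> \<delta> > 0 \<Longrightarrow> (\<Sum>t<n. cond_ent P (f t) g) + 2 * (real n * \<delta>) \<le> real L \<Longrightarrow>
      \<exists>b dec. (\<forall>s. length (b s :: bool list) = L) \<and>
        measure_pmf.prob (Pi_pmf {..<n} dflt (\<lambda>_. P))
          {\<omega>. dec (\<lambda>t. g (\<omega> t)) (b (\<lambda>t. if t < n then f t (\<omega> t) else s0)) \<noteq> (\<lambda>t. if t < n then f t (\<omega> t) else s0)}
        \<le> exp (- 2 * real n * \<delta>\<^sup>2 / B\<^sup>2) + 2 powr (- (real n * \<delta>))"
proof -
  obtain B where B: "B > 0" "\<And>(f :: 'a \<Rightarrow> 's) x. x \<in> set_pmf P \<Longrightarrow>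
      0 \<le> - log 2 (pmf (map_pmf (\<lambda>x. (f x, g x)) P) (f x, g x) / pmf (map_pmf g P) (g x)) \<and>
      - log 2 (pmf (map_pmf (\<lambda>x. (f x, g x)) P) (f x, g x) / pmf (map_pmf g P) (g x)) \<le> B"
    by (rule cond_self_information_bounded[OF fin, of g]) (rule that)
  show ?thesis
  proof (rule that[OF B(1)])
    fix f :: "nat \<Rightarrow> 'a \<Rightarrow> 's" and n L :: nat and \<delta> :: real
    assume n: "n > 0" and \<delta>: "\<delta> > 0" and L: "(\<Sum>t<n. cond_ent P (f t) g) + 2 * (real n * \<delta>) \<le> real L"
    let ?Q = "Pi_pmf {..<n} dflt (\<lambda>_. P)"
    define S where "S = (\<lambda>\<omega> t. if t < n then f t (\<omega> t) else s0)"
    define Y where "Y = (\<lambda>\<omega> t. if t < n then g (\<omega> t) else g dflt)"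
    define M where "M = map_pmf (\<lambda>\<omega>. (S \<omega>, Y \<omega>)) ?Q"
    define J where "J = (\<lambda>t x. pmf (map_pmf (\<lambda>x. (f t x, g x)) P) (f t x, g x))"
    define m where "m = (\<lambda>x. pmf (map_pmf g P) (g x))"
    define a where "a = (\<lambda>t x. - log 2 (J t x / m x))"
    define r where "r = (\<Sum>t<n. cond_ent P (f t) g)"
    define \<theta> where "\<theta> = r + real n * \<delta>"
    define \<tau> where "\<tau> = 2 powr (- \<theta>)"
    let ?C = "{l :: bool list. length l = L}"
    note C = bool_lists_length[of L]
    have finQ: "finite (set_pmf ?Q)" using fin by (intro finite_set_Pi_pmf) auto
    have finM: "finite (set_pmf M)" unfolding M_def using finQ by simp
    have \<tau>: "\<tau> > 0" by (simp add: \<tau>_def)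
    obtain b dec where b: "range b \<subseteq> ?C"
      and err: "measure_pmf.prob M {(s, y). dec y (b s) \<noteq> s}
        \<le> measure_pmf.prob M {(s, y). pmf M (s, y) < \<tau> * pmf (map_pmf snd M) y} + 1 / (\<tau> * card ?C)"
      by (rule one_shot_Slepian_Wolf[OF finM C(1,3) \<tau>]) (rule that)
    have pmfM: "pmf M (S \<omega>, Y \<omega>) = (\<Prod>t<n. J t (\<omega> t))" for \<omega>
    proof -
      \<comment> \<open>Trades a pair of blocks for a block of pairs: injectivity preserves masses,
        and the law of the block of pairs is a product.\<close>
      define \<iota> :: "(nat \<Rightarrow> 's \<times> 'y) \<Rightarrow> (nat \<Rightarrow> 's) \<times> (nat \<Rightarrow> 'y)" where
        "\<iota> = (\<lambda>h. (\<lambda>t. fst (h t), \<lambda>t. snd (h t)))"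
      define SY where "SY = (\<lambda>\<omega> t. if t < n then (f t (\<omega> t), g (\<omega> t)) else (s0, g dflt))"
      have inj: "inj \<iota>"
        unfolding \<iota>_def by (auto simp: inj_def fun_eq_iff prod_eq_iff)
      have SY: "(S \<omega>, Y \<omega>) = \<iota> (SY \<omega>)" for \<omega>
        by (auto simp: \<iota>_def SY_def S_def Y_def fun_eq_iff)
      have "M = map_pmf \<iota> (map_pmf SY ?Q)" unfolding M_def SY by (simp add: pmf.map_comp o_def)
      hence "pmf M (S \<omega>, Y \<omega>) = pmf (map_pmf SY ?Q) (SY \<omega>)"
        unfolding SY by (simp add: pmf_map_inj'[OF inj])
      thus ?thesis
        unfolding SY_def J_def
        using pmf_map_Pi_pmf_coordinatewise[of n "\<lambda>t x. (f t x, g x)" "(s0, g dflt)" dflt "\<lambda>_. P" \<omega>] by simp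
    qed
    have pmfY: "pmf (map_pmf snd M) (Y \<omega>) = (\<Prod>t<n. m (\<omega> t))" for \<omega>
    proof -
      have "map_pmf snd M = map_pmf Y ?Q" unfolding M_def by (simp add: pmf.map_comp o_def)
      thus ?thesis
        unfolding Y_def m_def
        using pmf_map_Pi_pmf_coordinatewise[of n "\<lambda>t x. g x" "g dflt" dflt "\<lambda>_. P" \<omega>] by simp
    qed
    \<comment> \<open>The ratio of joint to marginal mass is 2 to the minus total self-information,
      so missing the threshold means exceeding the mean by at least
      \<open>n * \<delta>\<close>.\<close>
    have atyp: "r + real n * \<delta> \<le> (\<Sum>t<n. a t (\<omega> t))"
      if \<omega>: "\<omega> \<in> set_pmf ?Q" and lt: "pmf M (S \<omega>, Y \<omega>) < \<tau> * pmf (map_pmf snd M) (Y \<omega>)" for \<omega>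
    proof -
      have in_P: "\<omega> t \<in> set_pmf P" if "t < n" for t
        using \<omega> that by (auto simp: set_Pi_pmf PiE_dflt_def)
      have pos: "J t (\<omega> t) > 0" "m (\<omega> t) > 0" if "t < n" for t
        unfolding J_def m_def using in_P[OF that] by (auto intro!: pmf_positive)
      have mpos: "(\<Prod>t<n. m (\<omega> t)) > 0" using pos by (intro prod_pos) auto
      have "2 powr (- (\<Sum>t<n. a t (\<omega> t))) = (\<Prod>t<n. 2 powr (log 2 (J t (\<omega> t) / m (\<omega> t))))"
        by (simp add: a_def sum_negf powr_sum)
      also have "\<dots> = (\<Prod>t<n. J t (\<omega> t) / m (\<omega> t))"
        using pos by (intro prod.cong refl) (auto intro!: powr_log_cancel)
      also have "\<dots> = pmf M (S \<omega>, Y \<omega>) / pmf (map_pmf snd M) (Y \<omega>)"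
        by (simp add: pmfM pmfY prod_dividef)
      also have "\<dots> < \<tau>" using lt mpos by (simp add: pmfY divide_less_eq)
      finally have "- (\<Sum>t<n. a t (\<omega> t)) < - \<theta>" unfolding \<tau>_def by simp
      thus ?thesis unfolding \<theta>_def by simp
    qed
    have Ea: "(\<Sum>t<n. measure_pmf.expectation P (a t)) = r"
      unfolding r_def a_def J_def m_def by (intro sum.cong refl cond_ent_eq_expectation[OF fin, symmetric])
    have "measure_pmf.prob M {(s, y). pmf M (s, y) < \<tau> * pmf (map_pmf snd M) y}
        = measure_pmf.prob ?Q {\<omega>. pmf M (S \<omega>, Y \<omega>) < \<tau> * pmf (map_pmf snd M) (Y \<omega>)}"
      by (subst M_def, subst measure_map_pmf) (simp add: vimage_def)
    also have "\<dots> \<le> measure_pmf.prob ?Q {\<omega>. (\<Sum>t<n. measure_pmf.expectation P (a t)) + real n * \<delta> \<le> (\<Sum>t<n. a t (\<omega> t))}"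
      unfolding Ea using atyp by (intro measure_pmf.finite_measure_mono_AE) (auto simp: AE_measure_pmf_iff)
    also have "\<dots> \<le> exp (- 2 * real n * \<delta>\<^sup>2 / B\<^sup>2)"
      by (rule Pi_pmf_sum_upper_tail) (use B n \<delta> in \<open>auto simp: a_def J_def m_def\<close>)
    finally have t1: "measure_pmf.prob M {(s, y). pmf M (s, y) < \<tau> * pmf (map_pmf snd M) y}
        \<le> exp (- 2 * real n * \<delta>\<^sup>2 / B\<^sup>2)" .
    have "1 / (\<tau> * card ?C) = 2 powr (\<theta> - real L)"
      by (simp add: C \<tau>_def powr_diff powr_minus powr_realpow field_simps)
    also have "\<dots> \<le> 2 powr (- (real n * \<delta>))"
      using L unfolding \<theta>_def r_def by (intro powr_mono) linarith+
    finally have t2: "1 / (\<tau> * card ?C) \<le> 2 powr (- (real n * \<delta>))" .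
    have "measure_pmf.prob ?Q {\<omega>. dec (\<lambda>t. g (\<omega> t)) (b (S \<omega>)) \<noteq> S \<omega>}
        = measure_pmf.prob ?Q {\<omega>. dec (Y \<omega>) (b (S \<omega>)) \<noteq> S \<omega>}"
    proof (rule measure_pmf.finite_measure_eq_AE)
      have "Y \<omega> = (\<lambda>t. g (\<omega> t))" if "\<omega> \<in> set_pmf ?Q" for \<omega>
        using set_Pi_pmf_dflt[OF that] by (auto simp: Y_def)
      thus "AE \<omega> in ?Q. \<omega> \<in> {\<omega>. dec (\<lambda>t. g (\<omega> t)) (b (S \<omega>)) \<noteq> S \<omega>} \<longleftrightarrow> \<omega> \<in> {\<omega>. dec (Y \<omega>) (b (S \<omega>)) \<noteq> S \<omega>}"
        by (auto simp: AE_measure_pmf_iff)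
    qed auto
    also have "\<dots> = measure_pmf.prob M {(s, y). dec y (b s) \<noteq> s}"
      unfolding M_def by (simp add: vimage_def)
    also have "\<dots> \<le> exp (- 2 * real n * \<delta>\<^sup>2 / B\<^sup>2) + 2 powr (- (real n * \<delta>))"
      using err t1 t2 by linarith
    finally show "\<exists>b dec. (\<forall>s. length (b s :: bool list) = L) \<and>
        measure_pmf.prob (Pi_pmf {..<n} dflt (\<lambda>_. P))
          {\<omega>. dec (\<lambda>t. g (\<omega> t)) (b (\<lambda>t. if t < n then f t (\<omega> t) else s0)) \<noteq> (\<lambda>t. if t < n then f t (\<omega> t) else s0)}
        \<le> exp (- 2 * real n * \<delta>\<^sup>2 / B\<^sup>2) + 2 powr (- (real n * \<delta>))"
      using b unfolding S_def by (intro exI[of _ b] exI[of _ dec]) auto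
  qed
qed

subsection \<open>Achievability\<close>

fun crypt :: "bool list \<Rightarrow> bool list \<Rightarrow> bool list" where
  "crypt (k # ks) (l # ls) = (k \<noteq> l) # crypt ks ls"
| "crypt _ ls = ls"

lemma length_crypt [simp]: "length (crypt ks ls) = length ls"
  by (induction ks ls rule: crypt.induct) auto

lemma crypt_crypt [simp]: "crypt ks (crypt ks ls) = ls"
  by (induction ks ls rule: crypt.induct) auto

text \<open>Plaintext and ciphertext determine the pad, which makes the key a function of source
  block and transmission. The length condition keeps the end of the key from being lost.\<close>

lemma crypt_recover_key:
  "length ks \<le> length ls \<Longrightarrow> take (length ks) (map2 (\<noteq>) (crypt ks ls) ls) = ks"
  by (induction ks ls rule: crypt.induct) auto

definition uniform_key :: "nat \<Rightarrow> nat pmf" where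
  "uniform_key m = map_pmf to_nat (pmf_of_set {l :: bool list. length l = m})"

lemma set_uniform_key: "set_pmf (uniform_key m) = to_nat ` {l :: bool list. length l = m}"
  by (simp add: uniform_key_def set_pmf_of_set[OF bool_lists_length(3,1)])

lemma ent_uniform_key: "ent (uniform_key m) (\<lambda>k. k) = m"
proof -
  let ?U = "pmf_of_set {l :: bool list. length l = m}"
  have fin: "finite (set_pmf ?U)"
    by (simp add: bool_lists_length set_pmf_of_set[OF bool_lists_length(3,1)])
  have "ent (uniform_key m) (\<lambda>k. k) = ent ?U to_nat"
    unfolding uniform_key_def by (simp add: ent_map_pmf[OF fin])
  also have "\<dots> = ent ?U (\<lambda>l. l)"
    by (rule ent_eq_if_functions[OF fin, where \<phi> = to_nat and \<psi> = from_nat]) simp_all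
  also have "\<dots> = measure_pmf.expectation ?U (\<lambda>_. real m)"
    unfolding ent_eq_expectation[OF fin]
    by (intro expectation_cong_support)
      (auto simp: set_pmf_of_set[OF bool_lists_length(3,1)] pmf_of_set[OF bool_lists_length(3,1)]
        bool_lists_length log_divide log_nat_power indicator_def)
  finally show ?thesis by simp
qed

lemma lower_convex_env_nonneg:
  assumes "\<And>D'. 0 \<le> r D'"
  shows "0 \<le> lower_convex_env r D"
proof -
  have "convex_on UNIV (\<lambda>_ :: real. 0 :: real)" by (rule convex_onI) auto
  hence "ereal ((\<lambda>_. 0) D) \<le> lower_convex_env r D"
    unfolding lower_convex_env_def using assms
    by (intro Sup_upper CollectI exI[of _ "\<lambda>_. 0"]) (auto simp: zero_ereal_def)
  thus ?thesis by (simp add: zero_ereal_def)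
qed

section \<open>Symbolwise coders as points of the distortion-rate plane\<close>

text \<open>No distortion constraint is imposed: \<open>rc_SI\<close> at level D is the infimum of
  the second coordinate over points whose first coordinate is at most D, and time sharing reaches
  the convex hull.\<close>

definition distortion_rate_pairs :: "'x::finite pmf \<Rightarrow> ('x \<Rightarrow> 'y::finite pmf) \<Rightarrow> ('y \<Rightarrow> 'w::finite pmf)
    \<Rightarrow> ('x \<Rightarrow> 'xh::finite \<Rightarrow> real) \<Rightarrow> (real \<times> real) set" where
  "distortion_rate_pairs Px Py Pw d =
    {(measure_pmf.expectation (src Px Py Pw) (\<lambda>(x,y,w). d x ((G :: nat \<Rightarrow> 'y \<Rightarrow> 'xh) (F x) y)),
      cond_ent (src Px Py Pw) (\<lambda>(x,y,w). F x) (\<lambda>(x,y,w). y)) | F G. \<forall>x. F x < CARD('x)}"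

lemma bounded_distortion_rate_pairs:
  fixes Px :: "'x::finite pmf" and Py :: "'x \<Rightarrow> 'y::finite pmf" and Pw :: "'y \<Rightarrow> 'w::finite pmf"
    and d :: "'x \<Rightarrow> 'xh::finite \<Rightarrow> real"
  shows "bounded (distortion_rate_pairs Px Py Pw d)"
proof -
  \<comment> \<open>Only the values \<open>G (F x) y\<close> matter; indexing them by
    \<open>x\<close> instead of \<open>nat\<close> makes the parameter set finite.\<close>
  define \<Phi> where "\<Phi> = (\<lambda>(F :: 'x \<Rightarrow> nat, G :: 'x \<Rightarrow> 'y \<Rightarrow> 'xh).
    (measure_pmf.expectation (src Px Py Pw) (\<lambda>(x,y,w). d x (G x y)),
     cond_ent (src Px Py Pw) (\<lambda>(x,y,w). F x) (\<lambda>(x,y,w). y)))"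
  have "finite (PiE (UNIV :: 'x set) (\<lambda>_. {..<CARD('x)}))" by (intro finite_PiE) auto
  hence "finite (\<Phi> ` (PiE (UNIV :: 'x set) (\<lambda>_. {..<CARD('x)}) \<times> UNIV))" by simp
  moreover have "distortion_rate_pairs Px Py Pw d \<subseteq> \<Phi> ` (PiE (UNIV :: 'x set) (\<lambda>_. {..<CARD('x)}) \<times> UNIV)"
  proof
    fix p assume "p \<in> distortion_rate_pairs Px Py Pw d"
    then obtain F G where FG: "\<forall>x. F x < CARD('x)"
      "p = (measure_pmf.expectation (src Px Py Pw) (\<lambda>(x,y,w). d x ((G :: nat \<Rightarrow> 'y \<Rightarrow> 'xh) (F x) y)),
        cond_ent (src Px Py Pw) (\<lambda>(x,y,w). F x) (\<lambda>(x,y,w). y))"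
      unfolding distortion_rate_pairs_def by blast
    hence "p = \<Phi> (F, \<lambda>x. G (F x))" by (simp add: \<Phi>_def)
    moreover have "F \<in> PiE UNIV (\<lambda>_. {..<CARD('x)})" using FG(1) by auto
    ultimately show "p \<in> \<Phi> ` (PiE (UNIV :: 'x set) (\<lambda>_. {..<CARD('x)}) \<times> UNIV)" by blast
  qed
  ultimately show ?thesis by (meson finite_subset finite_imp_bounded)
qed

text \<open>The form in which \<open>lower_convex_env_mixture\<close> asks for its function
  \<open>r\<close>.\<close>

lemma le_rc_SI:
  fixes Px :: "'x::finite pmf" and Py :: "'x \<Rightarrow> 'y::finite pmf" and Pw :: "'y \<Rightarrow> 'w::finite pmf"
    and d :: "'x \<Rightarrow> 'xh::finite \<Rightarrow> real"
  assumes "\<And>q. q \<in> distortion_rate_pairs Px Py Pw d \<Longrightarrow> fst q \<le> D \<Longrightarrow> b \<le> snd q"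
  shows "ereal b \<le> rc_SI Px Py Pw d D"
  unfolding rc_SI_def
proof (rule Inf_greatest)
  fix r
  assume "r \<in> {ereal (cond_ent (src Px Py Pw) (\<lambda>(x,y,w). f x) (\<lambda>(x,y,w). y)) | f g.
      (\<forall>x. f x < CARD('x)) \<and>
      measure_pmf.expectation (src Px Py Pw) (\<lambda>(x,y,w). d x ((g :: nat \<Rightarrow> 'y \<Rightarrow> 'xh) (f x) y)) \<le> D}"
  then obtain F G where FG: "r = ereal (cond_ent (src Px Py Pw) (\<lambda>(x,y,w). F x) (\<lambda>(x,y,w). y))"
    "\<forall>x. F x < CARD('x)"
    "measure_pmf.expectation (src Px Py Pw) (\<lambda>(x,y,w). d x ((G :: nat \<Rightarrow> 'y \<Rightarrow> 'xh) (F x) y)) \<le> D"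
    by blast
  hence "(measure_pmf.expectation (src Px Py Pw) (\<lambda>(x,y,w). d x (G (F x) y)),
      cond_ent (src Px Py Pw) (\<lambda>(x,y,w). F x) (\<lambda>(x,y,w). y)) \<in> distortion_rate_pairs Px Py Pw d"
    unfolding distortion_rate_pairs_def by blast
  from assms[OF this] show "ereal b \<le> r" using FG by simp
qed

lemma snd_distortion_rate_pairs_nonneg:
  "q \<in> distortion_rate_pairs Px Py Pw d \<Longrightarrow> 0 \<le> snd q"
  by (auto simp: distortion_rate_pairs_def cond_ent_nonneg)

lemma rc_SI_nonneg: "0 \<le> rc_SI Px Py Pw d D"
  unfolding zero_ereal_def by (rule le_rc_SI) (rule snd_distortion_rate_pairs_nonneg)

lemma distortion_rate_pairs_not_empty:
  "distortion_rate_pairs Px Py Pw d \<noteq> {}"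
  by (auto simp: distortion_rate_pairs_def intro!: exI[of _ "\<lambda>_. 0"])

text \<open>Symbolwise coding of \<open>S_t = f t X_t\<close>, Slepian-Wolf binning of \<open>S^n\<close> into \<open>L\<close> bits, and a one-time pad
  on the first \<open>m\<close> of these bits.\<close>
lemma code_within_one_time_pad:
  fixes Px :: "'x::finite pmf" and Py :: "'x \<Rightarrow> 'y::finite pmf" and Pw :: "'y \<Rightarrow> 'w::finite pmf"
    and d :: "'x \<Rightarrow> 'xh::finite \<Rightarrow> real" and f :: "nat \<Rightarrow> 'x \<Rightarrow> nat" and G :: "nat \<Rightarrow> nat \<Rightarrow> 'y \<Rightarrow> 'xh"
    and b :: "(nat \<Rightarrow> nat) \<Rightarrow> bool list"
  defines "P \<equiv> src Px Py Pw"
  assumes n: "n > 0" and m: "m \<le> L" and f: "\<And>t x. f t x < N"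
    and b: "\<And>s. length (b s) = L"
    and err: "measure_pmf.prob (src_n P n) {\<omega>. dec (\<lambda>t. fst (snd (\<omega> t)))
        (b (\<lambda>t. if t < n then f t (fst (\<omega> t)) else 0)) \<noteq> (\<lambda>t. if t < n then f t (fst (\<omega> t)) else 0)} < \<epsilon>"
    and L: "L / n \<le> R + \<epsilon>" and Rk: "m / n \<le> Rk + \<epsilon>"
    and dist: "(\<Sum>t<n. measure_pmf.expectation P (\<lambda>(x,y,w). d x (G t (f t x) y))) / n \<le> D + \<epsilon>"
    and h: "h - \<epsilon> \<le> cond_ent P (\<lambda>(x,y,w). x) (\<lambda>(x,y,w). w) + (real m - real L) / n"
  shows "\<exists>\<kappa> e g z gd. code_within Px Py Pw d R Rk D h \<epsilon> n \<kappa> e g z gd"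
proof -
  define \<kappa> where "\<kappa> = uniform_key m"
  define e where "e = (\<lambda>t (k :: nat) (x :: nat \<Rightarrow> 'x). f t (x t))"
  define g where "g = (\<lambda>t (k :: nat) s (y :: nat \<Rightarrow> 'y). G t (s t) (y t))"
  define z where "z = (\<lambda>k (x :: nat \<Rightarrow> 'x). crypt (from_nat k) (b (\<lambda>t. if t < n then f t (x t) else 0)))"
  define gd where "gd = (\<lambda>k (y :: nat \<Rightarrow> 'y) zz. dec y (crypt (from_nat k) zz))"
  interpret causal_code Px Py Pw d n \<kappa> e g z gd
    by unfold_locales (auto simp: \<kappa>_def set_uniform_key bool_lists_length e_def g_def)
  have P: "src Px Py Pw = P" by (simp add: P_def)
  have S: "S \<omega> = (\<lambda>t. if t < n then f t (X \<omega> t) else 0)" for \<omega> unfolding e_def ..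
  have map_snd: "map_pmf snd \<mu> = src_n P n" by (simp add: \<mu>_def map_snd_pair_pmf P)
  have bS: "length (Z \<omega>) = L" "crypt (from_nat (K \<omega>)) (Z \<omega>) = b (S \<omega>)" for \<omega>
    unfolding S by (simp_all add: z_def b)
  have K_len: "length (from_nat (K \<omega>) :: bool list) = m" "to_nat (from_nat (K \<omega>) :: bool list) = K \<omega>"
    if "\<omega> \<in> set_pmf \<mu>" for \<omega>
    using that unfolding \<mu>_def by (auto simp: \<kappa>_def set_uniform_key)
  have "measure_pmf.prob \<mu> err = measure_pmf.prob (map_pmf snd \<mu>) {\<omega>. dec (\<lambda>t. fst (snd (\<omega> t)))
        (b (\<lambda>t. if t < n then f t (fst (\<omega> t)) else 0)) \<noteq> (\<lambda>t. if t < n then f t (fst (\<omega> t)) else 0)}"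
  proof -
    have "err = {\<omega>. dec (Y \<omega>) (b (S \<omega>)) \<noteq> S \<omega>}"
      unfolding err_def by (rule Collect_cong) (unfold gd_def bS(2), rule neq_commute)
    thus ?thesis by (simp only: S measure_map_pmf vimage_def mem_Collect_eq)
  qed
  hence 1: "measure_pmf.prob \<mu> err < \<epsilon>" using err map_snd by simp
  have "Z ` set_pmf \<mu> \<subseteq> {l. length l = L}" using bS(1) by blast
  hence entZ: "ent \<mu> Z \<le> L"
    using ent_le_log_card[OF fin_\<mu> bool_lists_length(1)] by (simp add: bool_lists_length log_nat_power)
  have 2: "ent \<mu> Z / n \<le> R + \<epsilon>"
    using divide_right_mono[OF entZ, of "real n"] L by linarith
  have entK: "ent \<mu> K = m" unfolding ent_key by (simp add: \<kappa>_def ent_uniform_key)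
  have "measure_pmf.expectation \<mu> (\<lambda>\<omega>. d (X \<omega> t) (Xh \<omega> t))
      = measure_pmf.expectation P (\<lambda>(x,y,w). d x (G t (f t x) y))" if "t < n" for t
  proof -
    have "measure_pmf.expectation \<mu> (\<lambda>\<omega>. d (X \<omega> t) (Xh \<omega> t))
      = measure_pmf.expectation (map_pmf (\<lambda>\<omega>. \<omega> t) (map_pmf snd \<mu>)) (\<lambda>(x,y,w). d x (G t (f t x) y))"
      using that by (simp add: g_def e_def case_prod_unfold)
    also have "map_pmf (\<lambda>\<omega>. \<omega> t) (map_pmf snd \<mu>) = P"
      unfolding map_snd src_n_def using that by (simp add: Pi_pmf_component)
    finally show ?thesis .
  qed
  hence 3: "(\<Sum>t<n. measure_pmf.expectation \<mu> (\<lambda>\<omega>. d (X \<omega> t) (Xh \<omega> t))) / n \<le> D + \<epsilon>"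
    using dist by simp
  \<comment> \<open>The plaintext bin index is a function of X^n, so the pad can be read off (X^n,
    Z); \<open>take m\<close> drops the positions sent in clear. Independence of key and source then
    contributes the \<open>m\<close> bits.\<close>
  have "ent \<mu> (\<lambda>\<omega>. (K \<omega>, \<lambda>t. (X \<omega> t, W \<omega> t))) \<le> ent \<mu> (\<lambda>\<omega>. (X \<omega>, W \<omega>, Z \<omega>))"
  proof (rule ent_function_le[OF fin_\<mu>, where \<phi> = "\<lambda>(x, w, zz).
      (to_nat (take m (map2 (\<noteq>) zz (b (\<lambda>t. if t < n then f t (x t) else 0)))), \<lambda>t. (x t, w t))"])
    fix \<omega> assume \<omega>: "\<omega> \<in> set_pmf \<mu>"
    have "take m (map2 (\<noteq>) (Z \<omega>) (b (\<lambda>t. if t < n then f t (X \<omega> t) else 0))) = from_nat (K \<omega>)"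
      using crypt_recover_key[of "from_nat (K \<omega>)"] K_len(1)[OF \<omega>] m b by (simp add: z_def)
    thus "(K \<omega>, \<lambda>t. (X \<omega> t, W \<omega> t)) = (case (X \<omega>, W \<omega>, Z \<omega>) of (x, w, zz) \<Rightarrow>
      (to_nat (take m (map2 (\<noteq>) zz (b (\<lambda>t. if t < n then f t (x t) else 0)))), \<lambda>t. (x t, w t)))"
      using K_len(2)[OF \<omega>] by simp
  qed
  moreover have "ent \<mu> (\<lambda>\<omega>. (K \<omega>, \<lambda>t. (X \<omega> t, W \<omega> t))) = m + ent \<mu> (\<lambda>\<omega>. (X \<omega>, W \<omega>))"
    using ent_key_source[where \<phi> = "\<lambda>p. (fst p, snd (snd p))"] entK unfolding ent_XW ent_key by simp
  moreover have "ent \<mu> (\<lambda>\<omega>. (W \<omega>, Z \<omega>)) \<le> ent \<mu> W + L"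
    using ent_Pair_le[OF fin_\<mu>, of W Z] entZ by linarith
  ultimately have "n * H_XW + (real m - real L) \<le> cond_ent \<mu> X (\<lambda>\<omega>. (W \<omega>, Z \<omega>))"
    unfolding H_XW_eq cond_ent_def[of \<mu>] by linarith
  from divide_right_mono[OF this, of "real n"]
  have "H_XW + (real m - real L) / n \<le> cond_ent \<mu> X (\<lambda>\<omega>. (W \<omega>, Z \<omega>)) / n"
    using n by (simp add: add_divide_distrib)
  hence 4: "h - \<epsilon> \<le> cond_ent \<mu> X (\<lambda>\<omega>. (W \<omega>, Z \<omega>)) / n" using h unfolding P_def by linarith
  have "code_within Px Py Pw d R Rk D h \<epsilon> n \<kappa> e g z gd"
    unfolding code_within_def Let_def
  proof (intro conjI)
    show "\<exists>M. \<forall>t k x. e t k x < M" using f by (auto simp: e_def)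
    show "\<forall>t k x x'. (\<forall>i\<le>t. x i = x' i) \<longrightarrow> e t k x = e t k x'" by (simp add: e_def)
    show "\<forall>t k s s' y y'. (\<forall>i\<le>t. s i = s' i \<and> y i = y' i) \<longrightarrow> g t k s y = g t k s' y'" by (simp add: g_def)
    show "ent (pair_pmf \<kappa> (src_n (src Px Py Pw) n)) (\<lambda>\<omega>. fst \<omega>) / n \<le> Rk + \<epsilon>"
      using entK Rk by (simp add: \<mu>_def)
  qed (fact fin_key 1[unfolded err_def \<mu>_def] 2[unfolded \<mu>_def] 3[unfolded \<mu>_def] 4[unfolded \<mu>_def])+
  thus ?thesis by blast
qed

lemma RSI_achievable:
  fixes Px :: "'x::finite pmf" and Py :: "'x \<Rightarrow> 'y::finite pmf" and Pw :: "'y \<Rightarrow> 'w::finite pmf"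
    and d :: "'x \<Rightarrow> 'xh::finite \<Rightarrow> real"
  defines "P \<equiv> src Px Py Pw"
  defines "H \<equiv> cond_ent P (\<lambda>(x,y,w). x) (\<lambda>(x,y,w). w)"
  assumes env: "lower_convex_env (rc_SI Px Py Pw d) D = ereal v"
    and R: "v \<le> R" and h: "h \<le> H" and Rk: "h - H + v \<le> Rk" "Rk > 0" and \<epsilon>: "\<epsilon> > 0"
  shows "\<exists>N. \<forall>n\<ge>N. \<exists>\<kappa> e g z gd. code_within Px Py Pw d R Rk D h \<epsilon> n \<kappa> e g z gd"
proof -
  \<comment> \<open>The bit rate exceeds \<open>v\<close> by 4 \<delta>: one from the envelope, one
    from time sharing, two from binning. Rounding \<open>L\<close> and \<open>m\<close> costs one
    bit each, at most \<open>n * \<delta>\<close> bits, so no loss exceeds 6 \<delta>.\<close>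
  define \<delta> where "\<delta> = \<epsilon> / 8"
  have \<delta>: "\<delta> > 0" using \<epsilon> by (simp add: \<delta>_def)
  let ?A = "distortion_rate_pairs Px Py Pw d"
  have "0 \<le> lower_convex_env (rc_SI Px Py Pw d) D" by (intro lower_convex_env_nonneg rc_SI_nonneg)
  hence v: "v \<ge> 0" unfolding env by simp
  obtain q where q: "q \<in> convex hull ?A" "snd q \<le> v + \<delta>" "fst q \<le> D + \<delta>"
    by (rule lower_convex_env_mixture[OF distortion_rate_pairs_not_empty snd_distortion_rate_pairs_nonneg
          le_rc_SI eq_refl[OF env] \<delta>]) (assumption | rule that)+
  obtain s where s: "\<And>t. s t \<in> ?A" and avg: "\<And>\<delta>. \<delta> > 0 \<Longrightarrow> \<exists>N. \<forall>n\<ge>N.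
      (\<Sum>t<n. fst (s t)) \<le> real n * (fst q + \<delta>) \<and> (\<Sum>t<n. snd (s t)) \<le> real n * (snd q + \<delta>)"
    by (rule time_sharing_sequence[OF q(1) bounded_distortion_rate_pairs]) (rule that)
  have "\<forall>t. \<exists>F G. (\<forall>x. F x < CARD('x)) \<and>
      s t = (measure_pmf.expectation P (\<lambda>(x,y,w). d x ((G :: nat \<Rightarrow> 'y \<Rightarrow> 'xh) (F x) y)),
        cond_ent P (\<lambda>(x,y,w). F x) (\<lambda>(x,y,w). y))"
    using s unfolding distortion_rate_pairs_def P_def by blast
  then obtain F :: "nat \<Rightarrow> 'x \<Rightarrow> nat" and G :: "nat \<Rightarrow> nat \<Rightarrow> 'y \<Rightarrow> 'xh"
    where "\<forall>t. (\<forall>x. F t x < CARD('x)) \<and>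
      s t = (measure_pmf.expectation P (\<lambda>(x,y,w). d x (G t (F t x) y)),
        cond_ent P (\<lambda>(x,y,w). F t x) (\<lambda>(x,y,w). y))"
    unfolding choice_iff by (elim exE) (rule that)
  hence F: "\<And>t x. F t x < CARD('x)"
    and FG: "\<And>t. s t = (measure_pmf.expectation P (\<lambda>(x,y,w). d x (G t (F t x) y)),
        cond_ent P (\<lambda>(x,y,w). F t x) (\<lambda>(x,y,w). y))"
    by simp_all
  obtain N1 where N1: "\<And>n. n \<ge> N1 \<Longrightarrow>
      (\<Sum>t<n. fst (s t)) \<le> real n * (fst q + \<delta>) \<and> (\<Sum>t<n. snd (s t)) \<le> real n * (snd q + \<delta>)"
    using avg[OF \<delta>] by blast
  have finP: "finite (set_pmf P)" by simp
  obtain B where B: "B > 0" and SW: "\<And>(f :: nat \<Rightarrow> 'x \<times> 'y \<times> 'w \<Rightarrow> nat) n \<delta> L. n > 0 \<Longrightarrow> \<delta> > 0 \<Longrightarrow>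
      (\<Sum>t<n. cond_ent P (f t) (\<lambda>p. fst (snd p))) + 2 * (real n * \<delta>) \<le> real L \<Longrightarrow>
      \<exists>b dec. (\<forall>s. length (b s :: bool list) = L) \<and>
        measure_pmf.prob (Pi_pmf {..<n} undefined (\<lambda>_. P))
          {\<omega>. dec (\<lambda>t. fst (snd (\<omega> t))) (b (\<lambda>t. if t < n then f t (\<omega> t) else 0)) \<noteq> (\<lambda>t. if t < n then f t (\<omega> t) else 0)}
        \<le> exp (- 2 * real n * \<delta>\<^sup>2 / B\<^sup>2) + 2 powr (- (real n * \<delta>))"
    by (rule Slepian_Wolf_iid[OF finP, of "\<lambda>p. fst (snd p)" undefined 0]) (rule that)
  have "(\<lambda>n. exp (- 2 * real n * \<delta>\<^sup>2 / B\<^sup>2) + 2 powr (- (real n * \<delta>))) \<longlonglongrightarrow> 0"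
  proof -
    define x y where "x = exp (- 2 * \<delta>\<^sup>2 / B\<^sup>2)" and "y = 2 powr (- \<delta>)"
    have "exp (- 2 * real n * \<delta>\<^sup>2 / B\<^sup>2) + 2 powr (- (real n * \<delta>)) = x ^ n + y ^ n" for n
      by (simp add: x_def y_def exp_of_nat_mult[symmetric] powr_power mult_ac)
    moreover have "y < 2 powr 0" unfolding y_def using \<delta> by (intro powr_less_mono) auto
    hence "0 \<le> x" "x < 1" "0 \<le> y" "y < 1"
      using \<delta> B by (auto simp: x_def y_def)
    hence "(\<lambda>n. x ^ n + y ^ n) \<longlonglongrightarrow> 0 + 0" by (intro tendsto_add LIMSEQ_power_zero) auto
    ultimately show ?thesis by simp
  qed
  hence "eventually (\<lambda>n. exp (- 2 * real n * \<delta>\<^sup>2 / B\<^sup>2) + 2 powr (- (real n * \<delta>)) < \<epsilon>) sequentially"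
    using \<epsilon> by (rule order_tendstoD)
  then obtain N2 where N2: "\<And>n. n \<ge> N2 \<Longrightarrow> exp (- 2 * real n * \<delta>\<^sup>2 / B\<^sup>2) + 2 powr (- (real n * \<delta>)) < \<epsilon>"
    unfolding eventually_sequentially by blast
  show ?thesis
  proof (intro exI[of _ "max (max N1 N2) (max 1 (nat \<lceil>1 / \<delta>\<rceil>))"] allI impI)
    fix n assume "n \<ge> max (max N1 N2) (max 1 (nat \<lceil>1 / \<delta>\<rceil>))"
    hence n: "n \<ge> N1" "n \<ge> N2" "n > 0" "1 / \<delta> \<le> n" by linarith+
    have n\<delta>: "1 \<le> real n * \<delta>" using n(4) \<delta> by (simp add: field_simps)
    define L where "L = nat \<lceil>real n * (v + 4 * \<delta>)\<rceil>"
    \<comment> \<open>The pad is never longer than the bin index; if the key rate suffices, every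
      bit is encrypted.\<close>
    define m where "m = min L (nat \<lfloor>real n * Rk\<rfloor>)"
    have "0 \<le> real n * (v + 4 * \<delta>)" using v \<delta> by (intro mult_nonneg_nonneg) auto
    hence L: "real n * (v + 4 * \<delta>) \<le> real L" "real L \<le> real n * (v + 4 * \<delta>) + 1"
      unfolding L_def by linarith+
    have "0 \<le> real n * Rk" using Rk(2) by simp
    hence m: "m \<le> L" "real m \<le> real n * Rk" "m = L \<or> real n * Rk - 1 \<le> real m"
      unfolding m_def by linarith+
    have rate: "(\<Sum>t<n. cond_ent P (\<lambda>p. F t (fst p)) (\<lambda>p. fst (snd p))) \<le> real n * (v + 2 * \<delta>)"
    proof -
      have "(\<Sum>t<n. snd (s t)) \<le> real n * (snd q + \<delta>)" using N1[OF n(1)] by simp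
      also have "\<dots> \<le> real n * (v + 2 * \<delta>)" using q(2) by (intro mult_left_mono) auto
      finally show ?thesis by (simp add: FG case_prod_unfold)
    qed
    have "real n * (v + 2 * \<delta>) + 2 * (real n * \<delta>) = real n * (v + 4 * \<delta>)" by (simp add: algebra_simps)
    hence "(\<Sum>t<n. cond_ent P (\<lambda>p. F t (fst p)) (\<lambda>p. fst (snd p))) + 2 * (real n * \<delta>) \<le> real L"
      using rate L(1) by linarith
    from SW[OF n(3) \<delta> this] obtain b :: "(nat \<Rightarrow> nat) \<Rightarrow> bool list" and dec where b: "\<forall>s. length (b s) = L"
      and err: "measure_pmf.prob (Pi_pmf {..<n} undefined (\<lambda>_. P))
          {\<omega>. dec (\<lambda>t. fst (snd (\<omega> t))) (b (\<lambda>t. if t < n then F t (fst (\<omega> t)) else 0)) \<noteq> (\<lambda>t. if t < n then F t (fst (\<omega> t)) else 0)}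
        \<le> exp (- 2 * real n * \<delta>\<^sup>2 / B\<^sup>2) + 2 powr (- (real n * \<delta>))" by blast
    show "\<exists>\<kappa> e g z gd. code_within Px Py Pw d R Rk D h \<epsilon> n \<kappa> e g z gd"
    proof (rule code_within_one_time_pad[OF n(3) m(1) F])
      show "length (b s) = L" for s using b by simp
      show "measure_pmf.prob (src_n (src Px Py Pw) n) {\<omega>. dec (\<lambda>t. fst (snd (\<omega> t)))
        (b (\<lambda>t. if t < n then F t (fst (\<omega> t)) else 0)) \<noteq> (\<lambda>t. if t < n then F t (fst (\<omega> t)) else 0)} < \<epsilon>"
        using err N2[OF n(2)] unfolding src_n_def P_def by linarith
      have \<epsilon>\<delta>: "real n * \<epsilon> = 8 * (real n * \<delta>)" by (simp add: \<delta>_def)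
      have expand: "(R + \<epsilon>) * real n = real n * R + real n * \<epsilon>"
        "real n * (v + 4 * \<delta>) = real n * v + 4 * (real n * \<delta>)"
        "(h - \<epsilon>) * real n = real n * h - real n * \<epsilon>" "H * real n = real n * H"
        "real n * (h - H + v) = real n * h - real n * H + real n * v"
        by (simp_all add: algebra_simps)
      have "real n * v \<le> real n * R" using R by (intro mult_left_mono) auto
      hence "real L \<le> (R + \<epsilon>) * real n"
        using L(2) n\<delta> \<epsilon>\<delta> expand by linarith
      thus "real L / real n \<le> R + \<epsilon>" using n(3) by (simp add: pos_divide_le_eq)
      have "real m / real n \<le> Rk" using m(2) n(3) by (simp add: pos_divide_le_eq mult.commute)
      thus "real m / real n \<le> Rk + \<epsilon>" using \<epsilon> by linarith
      have "(\<Sum>t<n. fst (s t)) \<le> real n * (fst q + \<delta>)" using N1[OF n(1)] by simp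
      also have "\<dots> \<le> real n * (D + \<epsilon>)"
        using q(3) \<delta> by (intro mult_left_mono) (auto simp: \<delta>_def)
      finally show "(\<Sum>t<n. measure_pmf.expectation (src Px Py Pw) (\<lambda>(x,y,w). d x (G t (F t x) y))) / real n \<le> D + \<epsilon>"
        using n(3) by (simp add: FG P_def pos_divide_le_eq mult.commute)
      \<comment> \<open>Full encryption leaves the bound at \<open>H\<close>, where
        \<open>h \<le> H\<close> suffices; otherwise the whole key rate is spent, and the lower
        bound on \<open>Rk\<close> compensates the bits sent in clear.\<close>
      have "(h - \<epsilon>) * real n \<le> H * real n + (real m - real L)"
      proof (cases "m = L")
        case True
        have "(h - \<epsilon>) * real n \<le> H * real n" using h \<epsilon> by (intro mult_right_mono) auto
        thus ?thesis using True by simp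
      next
        case False
        hence "real n * Rk - 1 \<le> real m" using m(3) by simp
        moreover have "real n * (h - H + v) \<le> real n * Rk" using Rk by (intro mult_left_mono) auto
        ultimately show ?thesis
          using L(2) n\<delta> unfolding expand \<epsilon>\<delta> by linarith
      qed
      hence "h - \<epsilon> \<le> (H * real n + (real m - real L)) / real n" using n(3) by (simp add: pos_le_divide_eq)
      thus "h - \<epsilon> \<le> cond_ent (src Px Py Pw) (\<lambda>(x,y,w). x) (\<lambda>(x,y,w). w) + (real m - real L) / real n"
        using n(3) by (simp add: add_divide_distrib H_def P_def)
    qed
  qed
qed

theorem theorem6:
  fixes Px :: "'x::finite pmf" and Py :: "'x \<Rightarrow> 'y::finite pmf" and Pw :: "'y \<Rightarrow> 'w::finite pmf"
    and d :: "'x \<Rightarrow> 'xh::finite \<Rightarrow> real"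
    and R Rk D h :: real
  assumes "\<And>x xh. d x xh \<ge> 0"
    and "R > 0" and "Rk > 0" and "D > 0" and "h > 0"
  shows "in_RSI Px Py Pw d R Rk D h \<longleftrightarrow>
    ereal R \<ge> lower_convex_env (rc_SI Px Py Pw d) D \<and>
    h \<le> cond_ent (src Px Py Pw) (\<lambda>(x,y,w). x) (\<lambda>(x,y,w). w) \<and>
    ereal Rk \<ge> ereal (h - cond_ent (src Px Py Pw) (\<lambda>(x,y,w). x) (\<lambda>(x,y,w). w))
                + lower_convex_env (rc_SI Px Py Pw d) D"
proof -
  define H where "H = cond_ent (src Px Py Pw) (\<lambda>(x,y,w). x) (\<lambda>(x,y,w). w)"
  define E where "E = lower_convex_env (rc_SI Px Py Pw d) D"
  have E0: "0 \<le> E" unfolding E_def by (intro lower_convex_env_nonneg rc_SI_nonneg)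
  have "in_RSI Px Py Pw d R Rk D h \<longleftrightarrow> E \<le> ereal R \<and> h \<le> H \<and> ereal (h - H) + E \<le> ereal Rk"
  proof
    assume RSI: "in_RSI Px Py Pw d R Rk D h"
    have "E \<le> ereal R"
      unfolding E_def lower_convex_env_def
      by (rule Sup_least) (auto dest: RSI_converse(1)[OF RSI])
    moreover have "h \<le> H"
      unfolding H_def
    proof (rule RSI_converse(2)[OF RSI])
      show "convex_on UNIV (\<lambda>_ :: real. 0 :: real)" by (rule convex_onI) auto
      show "ereal 0 \<le> rc_SI Px Py Pw d D'" for D' using rc_SI_nonneg by (simp add: zero_ereal_def)
    qed
    \<comment> \<open>The finite shift is moved to the right so that the supremum can be bounded
      minorant by minorant.\<close>
    moreover have "E \<le> ereal (Rk - (h - H))"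
      unfolding E_def lower_convex_env_def
    proof (rule Sup_least)
      fix r assume "r \<in> {ereal (c D) | c. convex_on UNIV c \<and> (\<forall>D'. ereal (c D') \<le> rc_SI Px Py Pw d D')}"
      then obtain c where c: "r = ereal (c D)" "convex_on UNIV c" "\<And>D'. ereal (c D') \<le> rc_SI Px Py Pw d D'"
        by blast
      show "r \<le> ereal (Rk - (h - H))"
        using RSI_converse(3)[OF RSI c(2,3)] c(1) by (simp add: H_def)
    qed
    hence "ereal (h - H) + E \<le> ereal Rk" using E0 by (cases E) auto
    ultimately show "E \<le> ereal R \<and> h \<le> H \<and> ereal (h - H) + E \<le> ereal Rk" by blast
  next
    assume *: "E \<le> ereal R \<and> h \<le> H \<and> ereal (h - H) + E \<le> ereal Rk"
    \<comment> \<open>The bound by \<open>R\<close> excludes the value \<infinity> and nonnegativity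
      excludes the other end, so the envelope is finite here.\<close>
    then obtain v where v: "E = ereal v" using E0 by (cases E) auto
    have "v \<le> R" "h \<le> H" "h - H + v \<le> Rk" using * v by auto
    thus "in_RSI Px Py Pw d R Rk D h"
      unfolding in_RSI_iff_code_within
      using assms RSI_achievable[of Px Py Pw d D v R h Rk] v by (simp add: E_def H_def)
  qed
  thus ?thesis unfolding E_def H_def .
qed

end
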